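(* Let $m$ be an even positive integer and $p$ a positive divisor of $m$ such that $\frac mp$ is even, and suppose that either $n\ge3$, or $n=2$ and $p$ is odd. Let $c=(c_1,(c_\zeta)_{\zeta\in C_{m/p}\setminus\{1\}})$ be complex parameters and let $\underline c$ be given by $\underline c_1=-c_1$, $\underline c_\zeta=-c_\zeta$. If the rational Cherednik algebra $H_c(G(m,p,n))$ has (nonzero) finite-dimensional representations, then so does the negative braided Cherednik algebra $\underline H_{\underline c}(\mu(G(m,p,n)))$.
   Context: $[n]=\{1,\dots,n\}$; $C_k\subset\mathbb C^\times$ is the group of $k$-th roots of unity. $V$ is a complex vector space with basis $x_1,\dots,x_n$, $V^*$ has the dual basis $y_1,\dots,y_n$; $\mathrm{GL}(V)$ acts on $V^*$ by $\langle g(y),x\rangle=\langle y,g^{-1}(x)\rangle$. $\mathbb S_n\subset\mathrm{GL}(V)$ is the group of permutation matrices, $T(m,p,n)$ is the group of diagonal matrices $t$ with $t^m=\mathrm{id}$ and $\det(t)\in C_{m/p}$, and $G(m,p,n)=\mathbb S_n\ltimes T(m,p,n)$. For $m$ even, $\mu(G(m,p,n))=\{wt\mid w\in\mathbb S_n,\ t\in T(m,1,n),\ \det(wt)\in C_{m/p}\}$. For $\epsilon\in\mathbb C^\times$ and $i\ne j$, define elements of $\mathrm{GL}(V)$: $s_{ij}^{(\epsilon)}$: $x_i\mapsto\epsilon^{-1}x_j$, $x_j\mapsto\epsilon x_i$, $x_k\mapsto x_k$ ($k\ne i,j$); $\sigma_{ij}^{(\epsilon)}$: $x_i\mapsto\epsilon^{-1}x_j$,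 $x_j\mapsto-\epsilon x_i$, $x_k\mapsto x_k$ ($k\ne i,j$); $t_i^{(\epsilon)}$: $x_i\mapsto\epsilon x_i$, $x_k\mapsto x_k$ ($k\neq i$). $H_c(G(m,p,n))$ is the associative unital $\mathbb C$-algebra generated by $x_1,\dots,x_n\in V$, $y_1,\dots,y_n\in V^*$ and the group algebra of $G(m,p,n)$, subject to: $x_ix_j=x_jx_i$, $y_iy_j=y_jy_i$, $gx_i=g(x_i)g$, $gy_i=g(y_i)g$ for $g\in G(m,p,n)$; for $i\neq j$, $y_ix_j-x_jy_i=c_1\sum_{\epsilon\in C_m}\epsilon s_{ij}^{(\epsilon)}$; and $y_ix_i-x_iy_i=1-c_1\sum_{j\ne i}\sum_{\epsilon\in C_m}s_{ij}^{(\epsilon)}-\sum_{\zeta\in C_{m/p}\setminus\{1\}}c_\zeta t_i^{(\zeta)}$. For parameters $c'=(c'_1,(c'_\zeta))$, $\underline H_{c'}(\mu(G(m,p,n)))$ is the associative unital $\mathbb C$-algebra generated by a basis $\underline x_1,\dots,\underline x_n$ of $V$, the dual basis $\underline y_1,\dots,\underline y_n$ of $V^*$ and the group algebra of $\mu(G(m,p,n))$ (group elements act on the $\underline x_i$, $\underline y_i$ by the same formulas as on $x_i$, $y_i$), subject to: for $i\ne j$, $\underline x_i\underline x_j+\underline x_j\underline x_i=0$, $\underline y_i\underline y_j+\underline y_j\underline y_i=0$, $\underline y_i\underline x_j+\underline x_j\underline y_i=c'_1\sum_{\epsilon\in C_m}\epsilon\sigma_{ij}^{(\epsilon)}$; and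 for all $i$ and $g\in\mu(G(m,p,n))$, $g\underline x_i=g(\underline x_i)g$, $g\underline y_i=g(\underline y_i)g$, $\underline y_i\underline x_i-\underline x_i\underline y_i=1+c'_1\sum_{j\ne i}\sum_{\epsilon\in C_m}\sigma_{ij}^{(\epsilon)}+\sum_{\zeta\in C_{m/p}\setminus\{1\}}c'_\zeta t_i^{(\zeta)}$. *)

theory Defs
  imports
    "Jordan_Normal_Form.Determinant"
    "HOL-Library.Poly_Mapping"
    "HOL-Algebra.QuotRing"
    "HOL-Combinatorics.Permutations"
begin

section \<open>Complex algebras by generators and relations\<close>

text \<open>Words form a monoid under concatenation, written additively because the convolution
  product of \<^theory>\<open>HOL-Library.Poly_Mapping\<close> uses the additive notation.\<close>

instantiation list :: (type) monoid_add
begin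
definition zero_list :: "'a list" where "zero_list = []"
definition plus_list :: "'a list \<Rightarrow> 'a list \<Rightarrow> 'a list" where "plus_list = (@)"
instance by standard (simp_all add: zero_list_def plus_list_def)
end

type_synonym 'g ncpoly = "'g list \<Rightarrow>\<^sub>0 complex"

definition gen :: "'g \<Rightarrow> 'g ncpoly" where
  "gen g = Poly_Mapping.single [g] 1"

definition scal :: "complex \<Rightarrow> 'g ncpoly" where
  "scal a = Poly_Mapping.single [] a"

definition free_algebra :: "'g set \<Rightarrow> (complex, 'g ncpoly) module" where
  "free_algebra S = \<lparr>carrier = {f. \<forall>w\<in>Poly_Mapping.keys f. set w \<subseteq> S},
     mult = (*), one = 1, zero = 0, add = (+), module.smult = (\<lambda>a f. scal a * f)\<rparr>"

text \<open>The factor ring by a two-sided ideal, with the induced scalar multiplication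
  \<open>a (I + f) = I + a f\<close>.\<close>

definition quot_algebra :: "('k, 'a, 'm) module_scheme \<Rightarrow> 'a set \<Rightarrow> ('k, 'a set) module" where
  "quot_algebra A I = \<lparr>carrier = carrier (A Quot I), mult = mult (A Quot I),
     one = one (A Quot I), zero = zero (A Quot I), add = add (A Quot I),
     module.smult = (\<lambda>a C. \<Union>f\<in>C. I +>\<^bsub>A\<^esub> (a \<odot>\<^bsub>A\<^esub> f))\<rparr>"

definition presented_algebra :: "'g set \<Rightarrow> 'g ncpoly set \<Rightarrow> (complex, 'g ncpoly set) module" where
  "presented_algebra S R = quot_algebra (free_algebra S) (Idl\<^bsub>free_algebra S\<^esub> R)"

abbreviation Mat :: "nat \<Rightarrow> complex mat ring" where
  "Mat d \<equiv> ring_mat TYPE(complex) d ()"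

text \<open>A representation on \<open>\<complex>\<^sup>d\<close>: a unital homomorphism of complex algebras to the
  \<open>d \<times> d\<close> matrices. Every finite-dimensional representation has this form after a choice of basis.\<close>

definition representation ::
  "(complex, 'a, 'm) module_scheme \<Rightarrow> nat \<Rightarrow> ('a \<Rightarrow> complex mat) \<Rightarrow> bool" where
  "representation A d \<rho> \<longleftrightarrow> \<rho> \<in> ring_hom A (Mat d) \<and>
     (\<forall>a. \<forall>h\<in>carrier A. \<rho> (a \<odot>\<^bsub>A\<^esub> h) = a \<cdot>\<^sub>m \<rho> h)"

definition has_nonzero_fd_representation :: "(complex, 'a, 'm) module_scheme \<Rightarrow> bool" where
  "has_nonzero_fd_representation A \<longleftrightarrow> (\<exists>d>0. \<exists>\<rho>. representation A d \<rho>)"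

section \<open>The groups\<close>

text \<open>\<open>V = \<complex>\<^sup>n\<close> with basis \<open>x\<^sub>0, \<dots>, x\<^sub>n\<^sub>-\<^sub>1\<close> (indices start from 0);
  elements of \<open>GL(V)\<close> are matrices acting on columns.\<close>

definition roots :: "nat \<Rightarrow> complex set" where
  "roots k = {z. z ^ k = 1}"

text \<open>\<open>lin n f\<close> is the endomorphism \<open>x\<^sub>k \<mapsto> f k\<close>.\<close>

definition lin :: "nat \<Rightarrow> (nat \<Rightarrow> complex vec) \<Rightarrow> complex mat" where
  "lin n f = mat_of_cols n (map f [0..<n])"

definition perm_matrices :: "nat \<Rightarrow> complex mat set" where
  "perm_matrices n = {lin n (\<lambda>k. unit_vec n (\<pi> k)) | \<pi>. \<pi> permutes {..<n}}"

definition T_group :: "nat \<Rightarrow> nat \<Rightarrow> nat \<Rightarrow> complex mat set" where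
  "T_group m p n = {t \<in> carrier_mat n n.
     diagonal_mat t \<and> t ^\<^sub>m m = 1\<^sub>m n \<and> det t \<in> roots (m div p)}"

definition G_group :: "nat \<Rightarrow> nat \<Rightarrow> nat \<Rightarrow> complex mat set" where
  "G_group m p n = {w * t | w t. w \<in> perm_matrices n \<and> t \<in> T_group m p n}"

definition mu_group :: "nat \<Rightarrow> nat \<Rightarrow> nat \<Rightarrow> complex mat set" where
  "mu_group m p n = {w * t | w t. w \<in> perm_matrices n \<and> t \<in> T_group m 1 n \<and>
     det (w * t) \<in> roots (m div p)}"

definition s_elt :: "nat \<Rightarrow> nat \<Rightarrow> nat \<Rightarrow> complex \<Rightarrow> complex mat" where
  "s_elt n i j \<epsilon> = lin n (\<lambda>k.
     if k = i then inverse \<epsilon> \<cdot>\<^sub>v unit_vec n j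
     else if k = j then \<epsilon> \<cdot>\<^sub>v unit_vec n i else unit_vec n k)"

definition sigma_elt :: "nat \<Rightarrow> nat \<Rightarrow> nat \<Rightarrow> complex \<Rightarrow> complex mat" where
  "sigma_elt n i j \<epsilon> = lin n (\<lambda>k.
     if k = i then inverse \<epsilon> \<cdot>\<^sub>v unit_vec n j
     else if k = j then (- \<epsilon>) \<cdot>\<^sub>v unit_vec n i else unit_vec n k)"

definition t_elt :: "nat \<Rightarrow> nat \<Rightarrow> complex \<Rightarrow> complex mat" where
  "t_elt n i \<epsilon> = lin n (\<lambda>k. if k = i then \<epsilon> \<cdot>\<^sub>v unit_vec n i else unit_vec n k)"

text \<open>The dual action \<open>\<langle>g y, x\<rangle> = \<langle>y, g\<^sup>-\<^sup>1 x\<rangle>\<close>; covectors are given by their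
  coordinates with respect to the dual basis, so the pairing is the scalar product.\<close>

definition dual_act :: "nat \<Rightarrow> complex mat \<Rightarrow> complex vec \<Rightarrow> complex vec" where
  "dual_act n g y = vec n (\<lambda>j. y \<bullet> (inv\<^bsub>Mat n\<^esub> g *\<^sub>v unit_vec n j))"

section \<open>The two Cherednik algebras\<close>

datatype cgen = GX nat | GY nat | GG "complex mat"

abbreviation xg :: "nat \<Rightarrow> cgen ncpoly" where "xg i \<equiv> gen (GX i)"
abbreviation yg :: "nat \<Rightarrow> cgen ncpoly" where "yg i \<equiv> gen (GY i)"
abbreviation grp :: "complex mat \<Rightarrow> cgen ncpoly" where "grp g \<equiv> gen (GG g)"

definition x_of :: "nat \<Rightarrow> complex vec \<Rightarrow> cgen ncpoly" where
  "x_of n v = (\<Sum>j<n. scal (v $ j) * xg j)"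

definition y_of :: "nat \<Rightarrow> complex vec \<Rightarrow> cgen ncpoly" where
  "y_of n v = (\<Sum>j<n. scal (v $ j) * yg j)"

definition cherednik_gens :: "nat \<Rightarrow> complex mat set \<Rightarrow> cgen set" where
  "cherednik_gens n G = GX ` {..<n} \<union> GY ` {..<n} \<union> GG ` G"

text \<open>A relation \<open>l = r\<close> is encoded as the element \<open>l - r\<close>.\<close>

definition group_algebra_rels :: "nat \<Rightarrow> complex mat set \<Rightarrow> cgen ncpoly set" where
  "group_algebra_rels n G =
     {grp (1\<^sub>m n) - 1} \<union> {grp g * grp h - grp (g * h) | g h. g \<in> G \<and> h \<in> G}"

definition action_rels :: "nat \<Rightarrow> complex mat set \<Rightarrow> cgen ncpoly set" where
  "action_rels n G =
     {grp g * xg i - x_of n (g *\<^sub>v unit_vec n i) * grp g | g i. g \<in> G \<and> i < n} \<union>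
     {grp g * yg i - y_of n (dual_act n g (unit_vec n i)) * grp g | g i. g \<in> G \<and> i < n}"

text \<open>The parameters are \<open>c\<^sub>1\<close> and \<open>c\<^sub>\<zeta>\<close>; the function \<open>c\<close> enters only through its
  values on \<open>C\<^sub>m\<^sub>/\<^sub>p - {1}\<close>.\<close>

definition H_rels :: "nat \<Rightarrow> nat \<Rightarrow> nat \<Rightarrow> complex \<Rightarrow> (complex \<Rightarrow> complex) \<Rightarrow> cgen ncpoly set" where
  "H_rels m p n c1 c =
     {xg i * xg j - xg j * xg i | i j. i < n \<and> j < n} \<union>
     {yg i * yg j - yg j * yg i | i j. i < n \<and> j < n} \<union>
     {(yg i * xg j - xg j * yg i) -
        scal c1 * (\<Sum>\<epsilon>\<in>roots m. scal \<epsilon> * grp (s_elt n i j \<epsilon>)) | i j. i < n \<and> j < n \<and> i \<noteq> j} \<union>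
     {(yg i * xg i - xg i * yg i) -
        (1 - scal c1 * (\<Sum>j\<in>{..<n} - {i}. \<Sum>\<epsilon>\<in>roots m. grp (s_elt n i j \<epsilon>))
           - (\<Sum>\<zeta>\<in>roots (m div p) - {1}. scal (c \<zeta>) * grp (t_elt n i \<zeta>))) | i. i < n}"

definition cherednik_algebra ::
  "nat \<Rightarrow> nat \<Rightarrow> nat \<Rightarrow> complex \<Rightarrow> (complex \<Rightarrow> complex) \<Rightarrow> (complex, cgen ncpoly set) module" where
  "cherednik_algebra m p n c1 c =
     presented_algebra (cherednik_gens n (G_group m p n))
       (group_algebra_rels n (G_group m p n) \<union> action_rels n (G_group m p n) \<union> H_rels m p n c1 c)"

definition braided_H_rels ::
  "nat \<Rightarrow> nat \<Rightarrow> nat \<Rightarrow> complex \<Rightarrow> (complex \<Rightarrow> complex) \<Rightarrow> cgen ncpoly set" where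
  "braided_H_rels m p n c1 c =
     {xg i * xg j + xg j * xg i | i j. i < n \<and> j < n \<and> i \<noteq> j} \<union>
     {yg i * yg j + yg j * yg i | i j. i < n \<and> j < n \<and> i \<noteq> j} \<union>
     {(yg i * xg j + xg j * yg i) -
        scal c1 * (\<Sum>\<epsilon>\<in>roots m. scal \<epsilon> * grp (sigma_elt n i j \<epsilon>)) | i j. i < n \<and> j < n \<and> i \<noteq> j} \<union>
     {(yg i * xg i - xg i * yg i) -
        (1 + scal c1 * (\<Sum>j\<in>{..<n} - {i}. \<Sum>\<epsilon>\<in>roots m. grp (sigma_elt n i j \<epsilon>))
           + (\<Sum>\<zeta>\<in>roots (m div p) - {1}. scal (c \<zeta>) * grp (t_elt n i \<zeta>))) | i. i < n}"

definition neg_braided_cherednik_algebra ::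
  "nat \<Rightarrow> nat \<Rightarrow> nat \<Rightarrow> complex \<Rightarrow> (complex \<Rightarrow> complex) \<Rightarrow> (complex, cgen ncpoly set) module" where
  "neg_braided_cherednik_algebra m p n c1 c =
     presented_algebra (cherednik_gens n (mu_group m p n))
       (group_algebra_rels n (mu_group m p n) \<union> action_rels n (mu_group m p n) \<union>
        braided_H_rels m p n c1 c)"

section \<open>Well-formedness\<close>

text \<open>The ideal generated by a set \<open>R\<close> is meaningful only if \<open>R\<close> lies in the carrier of a ring; the
  lemmas below show that this is the case for both presentations. \<open>mon n a \<pi>\<close> is the monomial
  matrix \<open>x\<^sub>k \<mapsto> a\<^sub>k x\<^bsub>\<pi>(k)\<^esub>\<close>.\<close>

lemma free_algebra_carrier_iff:
  "f \<in> carrier (free_algebra S) \<longleftrightarrow> (\<forall>w\<in>Poly_Mapping.keys f. set w \<subseteq> S)"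
  by (simp add: free_algebra_def)

lemma free_algebra_carrierI:
  "0 \<in> carrier (free_algebra S)" "1 \<in> carrier (free_algebra S)"
  "scal a \<in> carrier (free_algebra S)"
  "g \<in> S \<Longrightarrow> gen g \<in> carrier (free_algebra S)"
  "f \<in> carrier (free_algebra S) \<Longrightarrow> h \<in> carrier (free_algebra S) \<Longrightarrow> f + h \<in> carrier (free_algebra S)"
  "f \<in> carrier (free_algebra S) \<Longrightarrow> h \<in> carrier (free_algebra S) \<Longrightarrow> f - h \<in> carrier (free_algebra S)"
  "f \<in> carrier (free_algebra S) \<Longrightarrow> - f \<in> carrier (free_algebra S)"
  "f \<in> carrier (free_algebra S) \<Longrightarrow> h \<in> carrier (free_algebra S) \<Longrightarrow> f * h \<in> carrier (free_algebra S)"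
  unfolding free_algebra_carrier_iff
  subgoal by simp
  subgoal by (simp add: zero_list_def)
  subgoal by (simp add: scal_def)
  subgoal by (simp add: gen_def)
  subgoal using Poly_Mapping.keys_add[of f h] by blast
  subgoal using keys_diff[of f h] by blast
  subgoal by simp
  subgoal using keys_mult[of f h] by (fastforce simp: plus_list_def)
  done

lemma free_algebra_carrier_sum:
  "(\<And>i. i \<in> I \<Longrightarrow> f i \<in> carrier (free_algebra S)) \<Longrightarrow> sum f I \<in> carrier (free_algebra S)"
  by (induction I rule: infinite_finite_induct) (auto intro: free_algebra_carrierI)

lemma ring_free_algebra: "ring (free_algebra S)"
proof (rule ringI)
  have sel: "add (free_algebra S) = (+)" "mult (free_algebra S) = (*)"
    "zero (free_algebra S) = 0" "one (free_algebra S) = 1"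
    by (simp_all add: free_algebra_def)
  show "abelian_group (free_algebra S)"
  proof (rule abelian_groupI)
    fix f assume "f \<in> carrier (free_algebra S)"
    then show "\<exists>h\<in>carrier (free_algebra S). h \<oplus>\<^bsub>free_algebra S\<^esub> f = \<zero>\<^bsub>free_algebra S\<^esub>"
      by (intro bexI[of _ "- f"] free_algebra_carrierI) (auto simp: sel)
  qed (simp_all add: sel free_algebra_carrierI add_ac)
  show "Group.monoid (free_algebra S)"
    by (rule monoidI) (simp_all add: sel free_algebra_carrierI mult.assoc)
  show "(a \<oplus>\<^bsub>free_algebra S\<^esub> b) \<otimes>\<^bsub>free_algebra S\<^esub> c =
      a \<otimes>\<^bsub>free_algebra S\<^esub> c \<oplus>\<^bsub>free_algebra S\<^esub> b \<otimes>\<^bsub>free_algebra S\<^esub> c"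
    "c \<otimes>\<^bsub>free_algebra S\<^esub> (a \<oplus>\<^bsub>free_algebra S\<^esub> b) =
      c \<otimes>\<^bsub>free_algebra S\<^esub> a \<oplus>\<^bsub>free_algebra S\<^esub> c \<otimes>\<^bsub>free_algebra S\<^esub> b" for a b c
    by (simp_all add: sel distrib_left distrib_right)
qed

definition mon :: "nat \<Rightarrow> (nat \<Rightarrow> complex) \<Rightarrow> (nat \<Rightarrow> nat) \<Rightarrow> complex mat" where
  "mon n a \<pi> = lin n (\<lambda>k. a k \<cdot>\<^sub>v unit_vec n (\<pi> k))"

lemma lin_carrier [simp]: "lin n f \<in> carrier_mat n n" "dim_row (lin n f) = n" "dim_col (lin n f) = n"
  by (auto simp: lin_def)

lemma lin_index: "i < n \<Longrightarrow> k < n \<Longrightarrow> lin n f $$ (i, k) = f k $ i"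
  by (simp add: lin_def mat_of_cols_index)

lemma lin_unit: "k < n \<Longrightarrow> f k \<in> carrier_vec n \<Longrightarrow> lin n f *\<^sub>v unit_vec n k = f k"
  by (rule eq_vecI) (auto simp: lin_index)

lemma lin_cong: "(\<And>k. k < n \<Longrightarrow> f k = g k) \<Longrightarrow> lin n f = lin n g"
  unfolding lin_def by (intro arg_cong[where f = "mat_of_cols n"] map_cong) auto

lemma mon_index: "i < n \<Longrightarrow> k < n \<Longrightarrow> mon n a \<pi> $$ (i, k) = (if i = \<pi> k then a k else 0)"
  by (auto simp: mon_def lin_index unit_vec_def)

lemma mon_carrier [simp]: "mon n a \<pi> \<in> carrier_mat n n" "dim_row (mon n a \<pi>) = n" "dim_col (mon n a \<pi>) = n"
  by (auto simp: mon_def)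

lemma mon_mult:
  assumes "\<rho> permutes {..<n}"
  shows "mon n a \<pi> * mon n b \<rho> = mon n (\<lambda>k. b k * a (\<rho> k)) (\<pi> \<circ> \<rho>)"
proof (rule eq_matI)
  fix i k assume ik: "i < dim_row (mon n (\<lambda>k. b k * a (\<rho> k)) (\<pi> \<circ> \<rho>))"
    "k < dim_col (mon n (\<lambda>k. b k * a (\<rho> k)) (\<pi> \<circ> \<rho>))"
  then have ik: "i < n" "k < n" by auto
  then have rk: "\<rho> k < n" using permutes_in_image[OF assms, of k] by auto
  have "(mon n a \<pi> * mon n b \<rho>) $$ (i, k) = (\<Sum>l<n. mon n a \<pi> $$ (i, l) * mon n b \<rho> $$ (l, k))"
    using ik by (auto simp: scalar_prod_def atLeast0LessThan intro!: sum.cong)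
  also have "\<dots> = (\<Sum>l<n. if l = \<rho> k then mon n a \<pi> $$ (i, \<rho> k) * b k else 0)"
    using ik by (intro sum.cong) (auto simp: mon_index)
  also have "\<dots> = mon n (\<lambda>k. b k * a (\<rho> k)) (\<pi> \<circ> \<rho>) $$ (i, k)"
    using ik rk by (auto simp: mon_index)
  finally show "(mon n a \<pi> * mon n b \<rho>) $$ (i, k) = mon n (\<lambda>k. b k * a (\<rho> k)) (\<pi> \<circ> \<rho>) $$ (i, k)" .
qed auto

lemma mon_one: "1\<^sub>m n = mon n (\<lambda>_. 1) id"
  by (rule eq_matI) (auto simp: mon_index)

lemma mon_cong: "(\<And>k. k < n \<Longrightarrow> a k = b k) \<Longrightarrow> mon n a \<pi> = mon n b \<pi>"
  unfolding mon_def by (rule lin_cong) auto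

lemma mon_id_pow: "mon n a id ^\<^sub>m r = mon n (\<lambda>k. a k ^ r) id"
proof (induction r)
  case 0
  then show ?case by (simp add: mon_one id_def)
next
  case (Suc r)
  then show ?case using mon_mult[OF permutes_id, of n "\<lambda>k. a k ^ r" id a]
    by (simp add: id_def comp_def)
qed

lemma det_mon_id: "det (mon n a id) = (\<Prod>k<n. a k)"
proof -
  have "upper_triangular (mon n a id)" by (auto simp: mon_index)
  then have "det (mon n a id) = prod_list (diag_mat (mon n a id))"
    by (rule det_upper_triangular[where n = n]) simp
  also have "\<dots> = (\<Prod>k<n. a k)"
    by (auto simp: prod_list_diag_prod mon_index atLeast0LessThan intro!: prod.cong)
  finally show ?thesis .
qed

lemma T_group_iff:
  "t \<in> T_group m p n \<longleftrightarrow>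
    (\<exists>a. t = mon n a id \<and> (\<forall>k<n. a k ^ m = 1) \<and> (\<Prod>k<n. a k) \<in> roots (m div p))"
proof
  assume t: "t \<in> T_group m p n"
  define a where "a k = t $$ (k, k)" for k
  have e: "t = mon n a id"
    using t by (intro eq_matI) (auto simp: T_group_def a_def mon_index diagonal_mat_def)
  have "mon n (\<lambda>k. a k ^ m) id = 1\<^sub>m n" using t e by (auto simp: T_group_def mon_id_pow)
  then have "a k ^ m = 1" if "k < n" for k
    using mon_index[of k n k "\<lambda>k. a k ^ m" id] that by auto
  then show "\<exists>a. t = mon n a id \<and> (\<forall>k<n. a k ^ m = 1) \<and> (\<Prod>k<n. a k) \<in> roots (m div p)"
    using t e by (intro exI[of _ a]) (auto simp: T_group_def det_mon_id)
next
  assume "\<exists>a. t = mon n a id \<and> (\<forall>k<n. a k ^ m = 1) \<and> (\<Prod>k<n. a k) \<in> roots (m div p)"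
  then show "t \<in> T_group m p n"
    by (auto simp: T_group_def mon_id_pow mon_one det_mon_id diagonal_mat_def mon_index intro!: mon_cong)
qed

lemma perm_matrices_iff: "w \<in> perm_matrices n \<longleftrightarrow> (\<exists>\<pi>. \<pi> permutes {..<n} \<and> w = mon n (\<lambda>_. 1) \<pi>)"
  by (auto simp: perm_matrices_def mon_def)

lemma G_group_iff: "g \<in> G_group m p n \<longleftrightarrow> (\<exists>\<pi> a. \<pi> permutes {..<n} \<and> g = mon n a \<pi> \<and>
    (\<forall>k<n. a k ^ m = 1) \<and> (\<Prod>k<n. a k) \<in> roots (m div p))"
proof -
  have m: "mon n a \<pi> = mon n (\<lambda>_. 1) \<pi> * mon n a id" for a \<pi>
    by (simp add: mon_mult permutes_id)
  show ?thesis (is "?L \<longleftrightarrow> ?R")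
  proof
    assume ?L
    then obtain w t where g: "g = w * t" "w \<in> perm_matrices n" "t \<in> T_group m p n"
      unfolding G_group_def by blast
    obtain \<pi> where w: "\<pi> permutes {..<n}" "w = mon n (\<lambda>_. 1) \<pi>"
      using g(2) unfolding perm_matrices_iff by blast
    obtain a where t: "t = mon n a id" "\<forall>k<n. a k ^ m = 1" "(\<Prod>k<n. a k) \<in> roots (m div p)"
      using g(3) unfolding T_group_iff by blast
    show ?R using w t g by (intro exI[of _ \<pi>] exI[of _ a]) (simp add: m[of a \<pi>, symmetric])
  next
    assume ?R
    then obtain \<pi> a where r: "\<pi> permutes {..<n}" "g = mon n a \<pi>" "\<forall>k<n. a k ^ m = 1" "(\<Prod>k<n. a k) \<in> roots (m div p)"
      by blast
    have "mon n (\<lambda>_. 1) \<pi> \<in> perm_matrices n" using r unfolding perm_matrices_iff by blast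
    moreover have "mon n a id \<in> T_group m p n" using r unfolding T_group_iff by blast
    moreover have "g = mon n (\<lambda>_. 1) \<pi> * mon n a id" using r(2) m[of a \<pi>] by (rule trans)
    ultimately show ?L using r(4) unfolding G_group_def mem_Collect_eq by metis
  qed
qed

lemma roots_one: "1 \<in> roots k" by (simp add: roots_def)
lemma roots_mult: "a \<in> roots k \<Longrightarrow> b \<in> roots k \<Longrightarrow> a * b \<in> roots k"
  by (simp add: roots_def power_mult_distrib)

lemma mu_group_iff: "g \<in> mu_group m p n \<longleftrightarrow> (\<exists>\<pi> a. \<pi> permutes {..<n} \<and> g = mon n a \<pi> \<and>
    (\<forall>k<n. a k ^ m = 1) \<and> det g \<in> roots (m div p))"
proof -
  have m: "mon n a \<pi> = mon n (\<lambda>_. 1) \<pi> * mon n a id" for a \<pi>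
    by (simp add: mon_mult permutes_id)
  have pr: "(\<Prod>k<n. a k) \<in> roots (m div 1)" if "\<forall>k<n. a k ^ m = 1" for a
    using that by (simp add: roots_def prod_power_distrib)
  show ?thesis (is "?L \<longleftrightarrow> ?R")
  proof
    assume ?L
    then obtain w t where g: "g = w * t" "w \<in> perm_matrices n" "t \<in> T_group m 1 n" "det g \<in> roots (m div p)"
      unfolding mu_group_def by blast
    obtain \<pi> where w: "\<pi> permutes {..<n}" "w = mon n (\<lambda>_. 1) \<pi>"
      using g(2) unfolding perm_matrices_iff by blast
    obtain a where t: "t = mon n a id" "\<forall>k<n. a k ^ m = 1" "(\<Prod>k<n. a k) \<in> roots (m div 1)"
      using g(3) unfolding T_group_iff by blast
    show ?R using w t g by (intro exI[of _ \<pi>] exI[of _ a]) (simp add: m[of a \<pi>, symmetric])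
  next
    assume ?R
    then obtain \<pi> a where r: "\<pi> permutes {..<n}" "g = mon n a \<pi>" "\<forall>k<n. a k ^ m = 1" "det g \<in> roots (m div p)"
      by blast
    have "mon n (\<lambda>_. 1) \<pi> \<in> perm_matrices n" using r unfolding perm_matrices_iff by blast
    moreover have "mon n a id \<in> T_group m 1 n" using r(3) pr[OF r(3)] unfolding T_group_iff by blast
    moreover have "g = mon n (\<lambda>_. 1) \<pi> * mon n a id" using r(2) m[of a \<pi>] by (rule trans)
    ultimately show ?L using r(4) unfolding mu_group_def mem_Collect_eq by metis
  qed
qed

lemma one_in_G: "1\<^sub>m n \<in> G_group m p n"
  unfolding G_group_iff
  by (intro exI[of _ id] exI[of _ "\<lambda>_. 1"]) (auto simp: mon_one roots_one permutes_id)

lemma one_in_mu: "1\<^sub>m n \<in> mu_group m p n"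
  unfolding mu_group_iff
  by (intro exI[of _ id] exI[of _ "\<lambda>_. 1"]) (auto simp: mon_one[symmetric] roots_one permutes_id)

lemma G_mult:
  assumes "g \<in> G_group m p n" "h \<in> G_group m p n" shows "g * h \<in> G_group m p n"
proof -
  obtain a \<pi> b \<rho> where
    g: "\<pi> permutes {..<n}" "g = mon n a \<pi>" "\<forall>k<n. a k ^ m = 1" "(\<Prod>k<n. a k) \<in> roots (m div p)" and
    h: "\<rho> permutes {..<n}" "h = mon n b \<rho>" "\<forall>k<n. b k ^ m = 1" "(\<Prod>k<n. b k) \<in> roots (m div p)"
    using assms unfolding G_group_iff by auto
  have "(\<Prod>k<n. a (\<rho> k)) = (\<Prod>k<n. a k)"
    using prod.permute[OF h(1), of a] by (simp add: o_def)
  then show ?thesis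
    unfolding G_group_iff using g h permutes_in_image[OF h(1)]
    by (intro exI[of _ "\<pi> \<circ> \<rho>"] exI[of _ "\<lambda>k. b k * a (\<rho> k)"])
       (auto simp: mon_mult permutes_compose power_mult_distrib prod.distrib intro!: roots_mult)
qed

lemma mu_mult:
  assumes "g \<in> mu_group m p n" "h \<in> mu_group m p n" shows "g * h \<in> mu_group m p n"
proof -
  obtain a \<pi> b \<rho> where
    g: "\<pi> permutes {..<n}" "g = mon n a \<pi>" "\<forall>k<n. a k ^ m = 1" "det g \<in> roots (m div p)" and
    h: "\<rho> permutes {..<n}" "h = mon n b \<rho>" "\<forall>k<n. b k ^ m = 1" "det h \<in> roots (m div p)"
    using assms unfolding mu_group_iff by auto
  have "det (g * h) = det g * det h" using g h by (intro det_mult[of _ n]) auto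
  then show ?thesis
    unfolding mu_group_iff using g h permutes_in_image[OF h(1)]
    by (intro exI[of _ "\<pi> \<circ> \<rho>"] exI[of _ "\<lambda>k. b k * a (\<rho> k)"])
       (auto simp: mon_mult permutes_compose power_mult_distrib intro!: roots_mult)
qed

lemma prod_two:
  fixes f :: "nat \<Rightarrow> complex"
  assumes "i < n" "j < n" "i \<noteq> j" "\<And>k. k \<noteq> i \<Longrightarrow> k \<noteq> j \<Longrightarrow> f k = 1"
  shows "(\<Prod>k<n. f k) = f i * f j"
proof -
  have "(\<Prod>k<n. f k) = (\<Prod>k\<in>{i,j}. f k)"
    using assms by (intro prod.mono_neutral_right) auto
  then show ?thesis using assms by simp
qed

lemma s_elt_in_G:
  assumes "i < n" "j < n" "i \<noteq> j" "\<epsilon> \<in> roots m" "m > 0"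
  shows "s_elt n i j \<epsilon> \<in> G_group m p n"
proof -
  let ?a = "\<lambda>k. if k = i then inverse \<epsilon> else if k = j then \<epsilon> else 1"
  have e: "\<epsilon> \<noteq> 0" "\<epsilon> ^ m = 1" using assms by (auto simp: roots_def zero_power)
  have "s_elt n i j \<epsilon> = mon n ?a (Transposition.transpose i j)"
    unfolding s_elt_def mon_def using assms by (intro lin_cong) (auto simp: transpose_def)
  moreover have "(\<Prod>k<n. ?a k) = 1"
    using prod_two[of i n j ?a] assms e by auto
  ultimately show ?thesis unfolding G_group_iff using assms e
    by (intro exI[of _ "Transposition.transpose i j"] exI[of _ ?a] conjI permutes_swap_id)
       (auto simp: roots_one power_inverse)
qed

lemma t_elt_mon: "t_elt n i \<zeta> = mon n (\<lambda>k. if k = i then \<zeta> else 1) id"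
  unfolding t_elt_def mon_def by (rule lin_cong) auto

lemma t_elt_prod: "i < (n :: nat) \<Longrightarrow> (\<Prod>k<n. if k = i then \<zeta> else 1) = (\<zeta> :: complex)"
  by (subst prod.delta) auto

lemma roots_div: "p dvd m \<Longrightarrow> \<zeta> \<in> roots (m div p) \<Longrightarrow> \<zeta> ^ m = 1"
  using power_mult[of \<zeta> "m div p" p] by (simp add: roots_def)

lemma t_elt_in_G:
  assumes "i < n" "\<zeta> \<in> roots (m div p)" "p dvd m"
  shows "t_elt n i \<zeta> \<in> G_group m p n"
  unfolding G_group_iff using assms
  by (intro exI[of _ id] exI[of _ "\<lambda>k. if k = i then \<zeta> else 1"])
     (auto simp: t_elt_mon t_elt_prod roots_div permutes_id)

lemma t_elt_in_mu:
  assumes "i < n" "\<zeta> \<in> roots (m div p)" "p dvd m"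
  shows "t_elt n i \<zeta> \<in> mu_group m p n"
  unfolding mu_group_iff using assms
  by (intro exI[of _ id] exI[of _ "\<lambda>k. if k = i then \<zeta> else 1"])
     (auto simp: t_elt_mon t_elt_prod roots_div permutes_id det_mon_id)

lemma sigma_elt_in_mu:
  assumes "i < n" "j < n" "i \<noteq> j" "\<epsilon> \<in> roots m" "m > 0" "even m"
  shows "sigma_elt n i j \<epsilon> \<in> mu_group m p n"
proof -
  let ?a = "\<lambda>k. if k = i then inverse \<epsilon> else if k = j then - \<epsilon> else 1"
  let ?\<tau> = "Transposition.transpose i j"
  have tau: "?\<tau> permutes {..<n}" using assms by (intro permutes_swap_id) auto
  have e: "\<epsilon> \<noteq> 0" "\<epsilon> ^ m = 1" using assms by (auto simp: roots_def zero_power)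
  have eq: "sigma_elt n i j \<epsilon> = mon n ?a ?\<tau>"
    unfolding sigma_elt_def mon_def using assms by (intro lin_cong) (auto simp: transpose_def)
  have "mon n ?a ?\<tau> = mon n (\<lambda>_. 1) ?\<tau> * mon n ?a id" by (simp add: mon_mult permutes_id)
  then have "det (mon n ?a ?\<tau>) = det (mon n (\<lambda>_. 1) ?\<tau>) * det (mon n ?a id)"
    by (simp add: det_mult[of _ n])
  also have "det (mon n ?a id) = -1"
    unfolding det_mon_id using prod_two[of i n j ?a] assms e by auto
  also have "mon n (\<lambda>_. 1) ?\<tau> = swaprows_mat n i j"
    using assms by (intro eq_matI) (auto simp: mon_index transpose_def)
  also have "det (swaprows_mat n i j) = (-1 :: complex)"
    using assms by (simp add: det_swaprows_mat)
  finally show ?thesis unfolding mu_group_iff using assms e tau eq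
    by (intro exI[of _ ?\<tau>] exI[of _ ?a])
       (auto simp: roots_one power_inverse)
qed

lemma cherednik_rels_carrier:
  assumes "m > 0" "p dvd m"
  shows "group_algebra_rels n (G_group m p n) \<union> action_rels n (G_group m p n) \<union> H_rels m p n c1 c
    \<subseteq> carrier (free_algebra (cherednik_gens n (G_group m p n)))"
  unfolding group_algebra_rels_def action_rels_def H_rels_def x_of_def y_of_def
  using assms
  by (auto simp: cherednik_gens_def one_in_G G_mult s_elt_in_G t_elt_in_G
      intro!: free_algebra_carrierI free_algebra_carrier_sum)

lemma braided_rels_carrier:
  assumes "m > 0" "even m" "p dvd m"
  shows "group_algebra_rels n (mu_group m p n) \<union> action_rels n (mu_group m p n) \<union> braided_H_rels m p n c1 c
    \<subseteq> carrier (free_algebra (cherednik_gens n (mu_group m p n)))"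
  unfolding group_algebra_rels_def action_rels_def braided_H_rels_def x_of_def y_of_def
  using assms
  by (auto simp: cherednik_gens_def one_in_mu mu_mult sigma_elt_in_mu t_elt_in_mu
      intro!: free_algebra_carrierI free_algebra_carrier_sum)

end

theory Submission
  imports Defs
begin

text \<open>The braided algebra is a sign twist of the Cherednik algebra, and a representation of the latter can
be twisted on its own underlying space.

Since \<open>m / p\<close> is even, \<open>- 1\<close> is an \<open>(m / p)\<close>-th root of unity. Hence a monomial matrix with entries in
\<open>C\<^sub>m\<close> has its determinant in \<open>C\<^bsub>m/p\<^esub>\<close> if and only if the product of its entries lies there: the two
groups \<open>G(m,p,n)\<close> and \<open>\<mu>(G(m,p,n))\<close> have the same elements. They contain all sign changes
\<open>t\<^sub>k = t\<^sub>k\<^bsup>(-1)\<^esup>\<close>. A representation \<open>M\<close> of the Cherednik algebra, given by operators \<open>X\<^sub>i\<close>, \<open>Y\<^sub>i\<close> and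
\<open>D(g)\<close>, therefore splits into simultaneous eigenspaces \<open>M\<^sub>\<chi>\<close> of the involutions \<open>\<tau>\<^sub>k = D(t\<^sub>k)\<close>, indexed by
sign vectors \<open>\<chi>\<close>. Both \<open>X\<^sub>i\<close> and \<open>Y\<^sub>i\<close> flip the sign \<open>\<chi>\<^sub>i\<close>, and \<open>D(g)\<close> permutes the signs.

To make the \<open>X\<^sub>i\<close> anticommute, tensor with a Clifford algebra on anticommuting generators
\<open>e\<^sub>1, \<dots>, e\<^sub>n\<close> of square \<open>1\<close>: let \<open>X\<^sub>i \<otimes> e\<^sub>i\<close>, \<open>Y\<^sub>i \<otimes> e\<^sub>i\<close> and \<open>D(g) \<otimes> (e\<^sub>k \<mapsto> e\<^bsub>\<pi>(k)\<^esub>)\<close> act on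
\<open>M \<otimes> Cl\<^sub>n\<close>, where \<open>\<pi>\<close> is the permutation underlying \<open>g\<close>. Write \<open>e\<^sub>\<chi>\<close> for the increasing product of the \<open>e\<^sub>k\<close> with
\<open>\<chi>\<^sub>k = -1\<close>. The subspace \<open>\<Oplus>\<^sub>\<chi> M\<^sub>\<chi> \<otimes> e\<^sub>\<chi>\<close> is stable, and as a vector space it is \<open>M\<close>. On \<open>M\<close> the action reads
\<open>X'\<^sub>i = X\<^sub>i \<Gamma>\<^sub>i\<close>, \<open>Y'\<^sub>i = Y\<^sub>i \<Gamma>\<^sub>i\<close>, \<open>D'(g) = D(g) \<Theta>\<^sub>\<pi>\<close>. Here \<open>\<Gamma>\<^sub>i = \<tau>\<^sub>1 \<cdots> \<tau>\<^bsub>i-1\<^esub>\<close> is the sign of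
sorting \<open>e\<^sub>i\<close> into \<open>e\<^sub>\<chi>\<close>, and \<open>\<Theta>\<^sub>\<pi>\<close> acts on \<open>M\<^sub>\<chi>\<close> by the sign of sorting the image of \<open>e\<^sub>\<chi>\<close> under \<open>\<pi>\<close>, that is,
by the parity of the number of inversions of \<open>\<pi>\<close> among the indices with \<open>\<chi>\<^sub>k = -1\<close>.

These operators satisfy the braided relations. The group law and the action relations are sign
identities on each \<open>M\<^sub>\<chi>\<close> (\<open>inversion_sign_compose\<close>, \<open>inversion_sign_flip\<close>). The twist turns commutators of
different indices into anticommutators and keeps those of equal index. For the reflections one
computes \<open>\<tau>\<^sub>j \<Theta>\<^bsub>(i j)\<^esub>\<close> (\<open>\<tau>_\<Theta>_swap\<close>): \<open>D'(\<sigma>\<^sub>i\<^sub>j\<^bsup>(\<epsilon>)\<^esup>)\<close> equals \<open>D(s\<^sub>i\<^sub>j\<^bsup>(\<epsilon>)\<^esup>)\<close> where \<open>\<chi>\<^sub>i = \<chi>\<^sub>j\<close> and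
\<open>\<mp> D(s\<^sub>i\<^sub>j\<^bsup>(\<epsilon>)\<^esup>) \<Gamma>\<^sub>i \<Gamma>\<^sub>j\<close> elsewhere. Because \<open>s\<^sub>i\<^sub>j\<^bsup>(\<epsilon>)\<^esup> t\<^sub>i t\<^sub>j = s\<^sub>i\<^sub>j\<^bsup>(-\<epsilon>)\<^esup>\<close>, the plain sum over
\<open>\<epsilon>\<close> sees only the first part and the sum weighted by \<open>\<epsilon>\<close> only the second, which gives the two kinds of
commutation relation with parameters \<open>- c\<close>.\<close>

section \<open>Complex algebras and evaluation of noncommutative polynomials\<close>

text \<open>A unital complex algebra, given by its structure map \<open>sc\<close> into the centre, so that scaling is a
  multiplication in the ring and values of noncommutative polynomials are ring expressions.\<close>

class complex_algebra_1 = ring_1 +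
  fixes sc :: "complex \<Rightarrow> 'a"
  assumes sc_add: "sc (a + b) = sc a + sc b"
    and sc_mult: "sc (a * b) = sc a * sc b"
    and sc_1 [simp]: "sc 1 = 1"
    and sc_commute: "sc a * x = x * sc a"
begin

lemma sc_0 [simp]: "sc 0 = 0"
  using sc_add[of 0 0] by simp

lemma sc_minus: "sc (- a) = - sc a"
  using sc_add[of a "- a"] by (simp add: eq_neg_iff_add_eq_0 add.commute)

end

text \<open>The algebra homomorphism from the free algebra that extends an assignment of the generators.\<close>

definition ev :: "('g \<Rightarrow> 'a::complex_algebra_1) \<Rightarrow> 'g ncpoly \<Rightarrow> 'a" where
  "ev \<phi> f = (\<Sum>w\<in>Poly_Mapping.keys f. sc (Poly_Mapping.lookup f w) * prod_list (map \<phi> w))"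

lemma ev_superset:
  assumes "finite A" "Poly_Mapping.keys f \<subseteq> A"
  shows "ev \<phi> f = (\<Sum>w\<in>A. sc (Poly_Mapping.lookup f w) * prod_list (map \<phi> w))"
  unfolding ev_def using assms by (intro sum.mono_neutral_left) (auto simp: in_keys_iff)

lemma ev_0 [simp]: "ev \<phi> 0 = 0"
  by (simp add: ev_def)

lemma ev_single [simp]: "ev \<phi> (Poly_Mapping.single w a) = sc a * prod_list (map \<phi> w)"
  by (subst ev_superset[of "{w}"]) auto

lemma ev_add: "ev \<phi> (f + h) = ev \<phi> f + ev \<phi> h"
proof -
  let ?A = "Poly_Mapping.keys f \<union> Poly_Mapping.keys h"
  have "ev \<phi> (f + h) = (\<Sum>w\<in>?A. sc (Poly_Mapping.lookup (f + h) w) * prod_list (map \<phi> w))"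
    by (rule ev_superset) (use Poly_Mapping.keys_add[of f h] in auto)
  also have "\<dots> = ev \<phi> f + ev \<phi> h"
    using ev_superset[of ?A f \<phi>] ev_superset[of ?A h \<phi>]
    by (simp only: lookup_add sc_add distrib_right sum.distrib finite_UnI
        Poly_Mapping.finite_keys Un_upper1 Un_upper2)
  finally show ?thesis .
qed

lemma ev_minus: "ev \<phi> (- f) = - ev \<phi> f"
  using ev_add[of \<phi> f "- f"] by (simp add: eq_neg_iff_add_eq_0 add.commute)

lemma ev_diff: "ev \<phi> (f - h) = ev \<phi> f - ev \<phi> h"
  using ev_add[of \<phi> f "- h"] by (simp add: ev_minus)

lemma ev_sum: "ev \<phi> (sum f A) = (\<Sum>a\<in>A. ev \<phi> (f a))"
  by (induction A rule: infinite_finite_induct) (simp_all add: ev_add)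

lemma ncpoly_eq_sum_monomials:
  fixes f :: "'g ncpoly"
  shows "f = (\<Sum>w\<in>Poly_Mapping.keys f. Poly_Mapping.single w (Poly_Mapping.lookup f w))"
  by (rule poly_mapping_eqI) (simp add: lookup_sum lookup_single when_def in_keys_iff)

lemma ev_mult: "ev \<phi> (f * h) = ev \<phi> f * ev \<phi> h"
proof -
  have single: "ev \<phi> (Poly_Mapping.single u a * Poly_Mapping.single w b) =
      ev \<phi> (Poly_Mapping.single u a) * ev \<phi> (Poly_Mapping.single w b)" for u w and a b :: complex
    by (simp add: mult_single plus_list_def sc_mult mult.assoc)
       (metis mult.assoc sc_commute)
  let ?s = "\<lambda>f w. Poly_Mapping.single w (Poly_Mapping.lookup f w)"
  have "f * h = (\<Sum>u\<in>Poly_Mapping.keys f. \<Sum>w\<in>Poly_Mapping.keys h. ?s f u * ?s h w)"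
    unfolding sum_product[symmetric] ncpoly_eq_sum_monomials[symmetric] ..
  then have "ev \<phi> (f * h) =
      (\<Sum>u\<in>Poly_Mapping.keys f. ev \<phi> (?s f u)) * (\<Sum>w\<in>Poly_Mapping.keys h. ev \<phi> (?s h w))"
    by (simp add: ev_sum single sum_product del: ev_single)
  then show ?thesis
    by (simp add: ev_def[of \<phi> f] ev_def[of \<phi> h])
qed

lemma single_one_list: "Poly_Mapping.single [] 1 = (1 :: 'g ncpoly)"
  using single_one[where 'a = "'g list"] by (simp add: zero_list_def)

lemma ev_1 [simp]: "ev \<phi> 1 = 1"
  using ev_single[of \<phi> "[]" 1] by (simp add: single_one_list)

lemma ev_gen [simp]: "ev \<phi> (gen g) = \<phi> g"
  by (simp add: gen_def)

lemma ev_scal [simp]: "ev \<phi> (scal a) = sc a"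
  by (simp add: scal_def)

lemmas ev_simps = ev_add ev_diff ev_minus ev_mult ev_sum

section \<open>Matrices as operators on a common space\<close>

text \<open>Matrix rings of different sizes \<open>d\<close> are all embedded, with their units, into one complex algebra: the
  linear operators on \<open>\<complex>\<^sup>\<nat>\<close>. The space is cut into consecutive blocks of length \<open>d\<close>, and a
  \<open>d \<times> d\<close> matrix acts on every block. Identities between matrices can then be proved by calculating in a
  type of class \<open>ring_1\<close>.\<close>

typedef endo = "{f :: (nat \<Rightarrow> complex) \<Rightarrow> nat \<Rightarrow> complex.
    (\<forall>u v. f (\<lambda>k. u k + v k) = (\<lambda>k. f u k + f v k)) \<and> (\<forall>a v. f (\<lambda>k. a * v k) = (\<lambda>k. a * f v k))}"
  morphisms app Endo
  by (rule exI[of _ "\<lambda>v. v"]) simp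

setup_lifting type_definition_endo

instantiation endo :: complex_algebra_1
begin

lift_definition zero_endo :: endo is "\<lambda>_ _. 0" by simp
lift_definition one_endo :: endo is "\<lambda>v. v" by simp
lift_definition plus_endo :: "endo \<Rightarrow> endo \<Rightarrow> endo" is "\<lambda>f g v k. f v k + g v k"
  by (auto simp: algebra_simps)
lift_definition minus_endo :: "endo \<Rightarrow> endo \<Rightarrow> endo" is "\<lambda>f g v k. f v k - g v k"
  by (auto simp: algebra_simps)
lift_definition uminus_endo :: "endo \<Rightarrow> endo" is "\<lambda>f v k. - f v k"
  by (auto simp: algebra_simps)
lift_definition times_endo :: "endo \<Rightarrow> endo \<Rightarrow> endo" is "\<lambda>f g v. f (g v)"
  by auto
lift_definition sc_endo :: "complex \<Rightarrow> endo" is "\<lambda>a v k. a * v k"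
  by (auto simp: algebra_simps)

instance
proof
  show "(0 :: endo) \<noteq> 1"
  proof
    assume "(0 :: endo) = 1"
    then have "app 0 (\<lambda>_. 1) 0 = app 1 (\<lambda>_. 1) 0" by simp
    then show False by (simp add: zero_endo.rep_eq one_endo.rep_eq)
  qed
qed (transfer; auto simp: algebra_simps fun_eq_iff)+

end

lift_definition block_op :: "nat \<Rightarrow> complex mat \<Rightarrow> endo" is
  "\<lambda>d M v k. \<Sum>r<d. M $$ (k mod d, r) * v (k div d * d + r)"
  by (auto simp: algebra_simps sum.distrib sum_distrib_left)

definition block_of :: "nat \<Rightarrow> endo \<Rightarrow> complex mat" where
  "block_of d E = mat d d (\<lambda>(r, s). app E (\<lambda>k. if k = s then 1 else 0) r)"

lemma block_of_block_op:
  assumes "M \<in> carrier_mat d d"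
  shows "block_of d (block_op d M) = M"
  using assms
  by (intro eq_matI) (auto simp: block_of_def block_op.rep_eq if_distrib cong: if_cong)

lemma block_of_carrier [simp]: "block_of d E \<in> carrier_mat d d"
  by (simp add: block_of_def)

lemma block_op_add:
  assumes "d > 0" "M \<in> carrier_mat d d" "N \<in> carrier_mat d d"
  shows "block_op d (M + N) = block_op d M + block_op d N"
  using assms
  by (intro app_inject[THEN iffD1] ext)
     (auto simp: block_op.rep_eq plus_endo.rep_eq distrib_right sum.distrib)

lemma block_op_smult:
  assumes "d > 0" "M \<in> carrier_mat d d"
  shows "block_op d (a \<cdot>\<^sub>m M) = sc a * block_op d M"
  using assms
  by (intro app_inject[THEN iffD1] ext)
     (auto simp: block_op.rep_eq times_endo.rep_eq sc_endo.rep_eq mult.assoc sum_distrib_left)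

lemma block_op_one:
  assumes "d > 0"
  shows "block_op d (1\<^sub>m d) = 1"
  using assms
  by (intro app_inject[THEN iffD1] ext)
     (auto simp: block_op.rep_eq one_endo.rep_eq if_distrib[of "\<lambda>x. x * _"] cong: if_cong)

lemma block_op_mult:
  assumes "d > 0" "M \<in> carrier_mat d d" "N \<in> carrier_mat d d"
  shows "block_op d (M * N) = block_op d M * block_op d N"
proof (intro app_inject[THEN iffD1] ext)
  fix v :: "nat \<Rightarrow> complex" and k
  let ?q = "k div d * d"
  have "app (block_op d (M * N)) v k =
      (\<Sum>r<d. (\<Sum>s<d. M $$ (k mod d, s) * N $$ (s, r)) * v (?q + r))"
    using assms by (auto simp: block_op.rep_eq scalar_prod_def atLeast0LessThan intro!: sum.cong)
  also have "\<dots> = (\<Sum>s<d. \<Sum>r<d. M $$ (k mod d, s) * (N $$ (s, r) * v (?q + r)))"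
    by (subst sum.swap) (simp add: sum_distrib_right mult.assoc)
  also have "\<dots> = app (block_op d M * block_op d N) v k"
    using assms by (auto simp: block_op.rep_eq times_endo.rep_eq sum_distrib_left intro!: sum.cong)
  finally show "app (block_op d (M * N)) v k = app (block_op d M * block_op d N) v k" .
qed

definition blocks :: "nat \<Rightarrow> endo set" where
  "blocks d = block_op d ` carrier_mat d d"

lemma blocksI: "M \<in> carrier_mat d d \<Longrightarrow> block_op d M \<in> blocks d"
  by (simp add: blocks_def)

lemma blocks_closed:
  assumes "d > 0"
  shows "1 \<in> blocks d" "0 \<in> blocks d" "sc a \<in> blocks d"
    and "E \<in> blocks d \<Longrightarrow> F \<in> blocks d \<Longrightarrow> E + F \<in> blocks d"
    and "E \<in> blocks d \<Longrightarrow> F \<in> blocks d \<Longrightarrow> E * F \<in> blocks d"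
    and "E \<in> blocks d \<Longrightarrow> F \<in> blocks d \<Longrightarrow> E - F \<in> blocks d"
proof -
  show one: "1 \<in> blocks d" using blocksI[of "1\<^sub>m d" d] assms by (simp add: block_op_one)
  show sc: "sc a \<in> blocks d" for a
    using blocksI[of "a \<cdot>\<^sub>m 1\<^sub>m d" d] assms by (simp add: block_op_one block_op_smult)
  show "0 \<in> blocks d" using sc[of 0] by simp
  show add: "E + F \<in> blocks d" if "E \<in> blocks d" "F \<in> blocks d" for E F
    using that assms by (auto simp: blocks_def simp flip: block_op_add)
  show mult: "E * F \<in> blocks d" if "E \<in> blocks d" "F \<in> blocks d" for E F
    using that assms by (auto simp: blocks_def simp flip: block_op_mult)
  show "E - F \<in> blocks d" if "E \<in> blocks d" "F \<in> blocks d"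
    using add[OF that(1) mult[OF sc[of "-1"] that(2)]] by (simp add: sc_minus)
qed

lemma blocks_prod_list:
  "d > 0 \<Longrightarrow> set xs \<subseteq> blocks d \<Longrightarrow> prod_list xs \<in> blocks d"
  by (induction xs) (auto simp: blocks_closed)

lemma blocks_sum:
  "d > 0 \<Longrightarrow> (\<And>a. a \<in> A \<Longrightarrow> f a \<in> blocks d) \<Longrightarrow> sum f A \<in> blocks d"
  by (induction A rule: infinite_finite_induct) (auto simp: blocks_closed)

lemma ev_in_blocks:
  assumes "d > 0" "range \<phi> \<subseteq> blocks d"
  shows "ev \<phi> f \<in> blocks d"
  unfolding ev_def using assms
  by (intro blocks_sum blocks_closed blocks_prod_list) auto

section \<open>Representations of presented algebras\<close>

lemma free_algebra_sel [simp]: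
  "add (free_algebra S) = (+)" "mult (free_algebra S) = (*)"
  "zero (free_algebra S) = 0" "one (free_algebra S) = 1"
  "module.smult (free_algebra S) = (\<lambda>a f. scal a * f)"
  by (simp_all add: free_algebra_def)

lemma single_Cons: "Poly_Mapping.single (g # w) 1 = gen g * Poly_Mapping.single w (1 :: complex)"
  by (simp add: gen_def mult_single plus_list_def)

lemma single_scal: "Poly_Mapping.single w a = scal a * Poly_Mapping.single w (1 :: complex)"
  by (simp add: scal_def mult_single plus_list_def)

lemma free_algebra_single:
  "set w \<subseteq> S \<Longrightarrow> Poly_Mapping.single w a \<in> carrier (free_algebra S)"
  by (simp add: free_algebra_carrier_iff)


lemma free_algebra_hom_eq_ev:
  assumes d: "d > 0"
    and \<rho>: "\<rho> \<in> ring_hom (free_algebra S) (Mat d)"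
    and smult: "\<And>a f. f \<in> carrier (free_algebra S) \<Longrightarrow> \<rho> (scal a * f) = a \<cdot>\<^sub>m \<rho> f"
    and \<phi>: "\<And>g. g \<in> S \<Longrightarrow> \<phi> g = block_op d (\<rho> (gen g))"
    and f: "f \<in> carrier (free_algebra S)"
  shows "block_op d (\<rho> f) = ev \<phi> f"
proof -
  note hom = ring_hom_memE[OF \<rho>, simplified]
  have closed: "\<rho> f \<in> carrier_mat d d" if "f \<in> carrier (free_algebra S)" for f
    using hom(1)[OF that] by (simp add: ring_mat_def)
  have add: "\<rho> (f + h) = \<rho> f + \<rho> h" and mult: "\<rho> (f * h) = \<rho> f * \<rho> h"
    if "f \<in> carrier (free_algebra S)" "h \<in> carrier (free_algebra S)" for f h
    using hom(2,3) that by (simp_all add: ring_mat_def)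
  have one: "\<rho> 1 = 1\<^sub>m d"
    using hom(4) by (simp add: ring_mat_def)
  have word: "block_op d (\<rho> (Poly_Mapping.single w 1)) = prod_list (map \<phi> w)" if "set w \<subseteq> S" for w
    using that
  proof (induction w)
    case Nil
    then show ?case using d by (simp add: single_one_list one block_op_one)
  next
    case (Cons g w)
    then have "gen g \<in> carrier (free_algebra S)" "Poly_Mapping.single w 1 \<in> carrier (free_algebra S)"
      by (simp_all add: free_algebra_carrierI free_algebra_single)
    with Cons d show ?case
      by (simp add: single_Cons mult block_op_mult closed \<phi>)
  qed
  have "block_op d (\<rho> (\<Sum>w\<in>A. Poly_Mapping.single w (c w))) = (\<Sum>w\<in>A. sc (c w) * prod_list (map \<phi> w))"
    if "finite A" "\<And>w. w \<in> A \<Longrightarrow> set w \<subseteq> S" for A and c :: "_ \<Rightarrow> complex"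
    using that
  proof (induction A rule: finite_induct)
    case empty
    have "\<rho> 0 = \<rho> (scal 0 * 1)" by (simp add: scal_def)
    also have "\<dots> = 0 \<cdot>\<^sub>m 1\<^sub>m d"
      using smult[of 1 0] by (simp add: one free_algebra_carrierI)
    finally show ?case using d by (simp add: block_op_smult)
  next
    case (insert w A)
    have w: "Poly_Mapping.single w a \<in> carrier (free_algebra S)" for a
      using insert.prems by (simp add: free_algebra_single)
    have A: "(\<Sum>w\<in>A. Poly_Mapping.single w (c w)) \<in> carrier (free_algebra S)"
      using insert.prems by (intro free_algebra_carrier_sum free_algebra_single) auto
    have "block_op d (\<rho> (Poly_Mapping.single w (c w))) = sc (c w) * prod_list (map \<phi> w)"
      using d w closed insert.prems word[of w]
      by (subst single_scal) (simp add: smult block_op_smult)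
    then show ?case
      using insert w A d by (simp add: add closed block_op_add)
  qed
  from this[of "Poly_Mapping.keys f" "Poly_Mapping.lookup f"] f show ?thesis
    unfolding ncpoly_eq_sum_monomials[symmetric] ev_def[symmetric]
    by (simp add: free_algebra_carrier_iff)
qed

text \<open>The union that defines scalar multiplication on cosets is a union of equal sets.\<close>

lemma quot_algebra_smult_coset:
  assumes I: "ideal I (free_algebra S)" and f: "f \<in> carrier (free_algebra S)"
  shows "a \<odot>\<^bsub>quot_algebra (free_algebra S) I\<^esub> (I +>\<^bsub>free_algebra S\<^esub> f) = I +>\<^bsub>free_algebra S\<^esub> (scal a * f)"
proof -
  interpret ideal I "free_algebra S" by (rule I)
  have "I +>\<^bsub>free_algebra S\<^esub> (scal a * h) = I +>\<^bsub>free_algebra S\<^esub> (scal a * f)"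
    if "h \<in> I +>\<^bsub>free_algebra S\<^esub> f" for h
  proof -
    from that obtain i where i: "i \<in> I" "h = i + f"
      by (auto simp: a_r_coset_def')
    then have "scal a * h = scal a * i + scal a * f"
      by (simp add: distrib_left)
    moreover have "scal a * i \<in> I"
      using I_l_closed[OF i(1), of "scal a"] by (simp add: free_algebra_carrierI)
    ultimately have "scal a * h \<in> I +>\<^bsub>free_algebra S\<^esub> (scal a * f)"
      by (auto simp: a_r_coset_def')
    then show ?thesis
      using f by (intro a_repr_independence[symmetric] additive_subgroup.a_subgroup)
        (auto simp: free_algebra_carrierI additive_subgroup_axioms)
  qed
  then have "(\<Union>h\<in>I +>\<^bsub>free_algebra S\<^esub> f. I +>\<^bsub>free_algebra S\<^esub> (scal a * h)) =
      I +>\<^bsub>free_algebra S\<^esub> (scal a * f)"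
    using a_rcos_self[OF f] by blast
  then show ?thesis
    by (simp add: quot_algebra_def)
qed

lemma quot_algebra_sel [simp]:
  "carrier (quot_algebra A I) = carrier (A Quot I)" "mult (quot_algebra A I) = mult (A Quot I)"
  "add (quot_algebra A I) = add (A Quot I)" "one (quot_algebra A I) = one (A Quot I)"
  by (simp_all add: quot_algebra_def)

lemma ring_hom_quot_algebra:
  "ring_hom (quot_algebra A I) B = ring_hom (A Quot I) B"
  by (simp add: ring_hom_def)

text \<open>This lemma and \<open>representation_of_relations\<close> together say that a representation of a presented
  algebra on \<open>\<complex>\<^sup>d\<close> amounts to a choice of one matrix per generator that satisfies the relations.
  Generators outside \<open>S\<close> are sent to \<open>0\<close>, so that \<open>ev\<close> can be applied to every polynomial.\<close>

lemma relations_of_representation: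
  assumes d: "d > 0" and R: "R \<subseteq> carrier (free_algebra S)"
    and rep: "representation (presented_algebra S R) d \<rho>"
  obtains \<phi> :: "'g \<Rightarrow> endo" where "range \<phi> \<subseteq> blocks d" "\<And>r. r \<in> R \<Longrightarrow> ev \<phi> r = 0"
proof -
  let ?F = "free_algebra S"
  define I where "I = Idl\<^bsub>?F\<^esub> R"
  interpret F: ring ?F by (rule ring_free_algebra)
  have I: "ideal I ?F"
    unfolding I_def by (rule F.genideal_ideal[OF R])
  interpret ideal I ?F by (rule I)
  define \<rho>' where "\<rho>' f = \<rho> (I +>\<^bsub>?F\<^esub> f)" for f
  have hom: "\<rho> \<in> ring_hom (?F Quot I) (Mat d)"
    using rep unfolding representation_def presented_algebra_def I_def[symmetric] ring_hom_quot_algebra by blast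
  have hom': "\<rho>' \<in> ring_hom ?F (Mat d)"
    using ring_hom_trans[OF rcos_ring_hom hom] unfolding \<rho>'_def comp_def .
  have smult: "\<rho>' (scal a * f) = a \<cdot>\<^sub>m \<rho>' f" if "f \<in> carrier ?F" for a f
  proof -
    have "I +>\<^bsub>?F\<^esub> f \<in> carrier (presented_algebra S R)"
      using that by (auto simp: presented_algebra_def I_def[symmetric] FactRing_def A_RCOSETS_def')
    with rep have "\<rho> (a \<odot>\<^bsub>presented_algebra S R\<^esub> (I +>\<^bsub>?F\<^esub> f)) = a \<cdot>\<^sub>m \<rho> (I +>\<^bsub>?F\<^esub> f)"
      unfolding representation_def by blast
    then show ?thesis
      unfolding presented_algebra_def I_def[symmetric] \<rho>'_def quot_algebra_smult_coset[OF I that] .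
  qed
  define \<phi> where "\<phi> g = (if g \<in> S then block_op d (\<rho>' (gen g)) else 0)" for g
  have carrier: "\<rho>' f \<in> carrier_mat d d" if "f \<in> carrier ?F" for f
    using ring_hom_memE(1)[OF hom' that] by (simp add: ring_mat_def)
  have ev: "ev \<phi> f = block_op d (\<rho>' f)" if "f \<in> carrier ?F" for f
    by (rule free_algebra_hom_eq_ev[OF d hom' smult _ that, symmetric]) (simp_all add: \<phi>_def)
  show thesis
  proof (rule that)
    show "range \<phi> \<subseteq> blocks d"
      using d by (auto simp: \<phi>_def blocksI carrier blocks_closed free_algebra_carrierI)
    fix r assume "r \<in> R"
    then have r: "r \<in> carrier ?F" "r \<in> I"
      using R F.genideal_self[OF R] by (auto simp: I_def)
    have "I +>\<^bsub>?F\<^esub> r = I +>\<^bsub>?F\<^esub> 0"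
      using a_rcos_const[OF r(2)] a_rcos_const[OF zero_closed] by simp
    then have "ev \<phi> r = ev \<phi> 0"
      using r(1) by (simp add: ev \<rho>'_def free_algebra_carrierI del: ev_0)
    then show "ev \<phi> r = 0" by simp
  qed
qed

text \<open>The polynomials with value \<open>0\<close> form an ideal that contains the relations, so the value depends only on
  the coset.\<close>

lemma representation_of_relations:
  fixes \<phi> :: "'g \<Rightarrow> endo"
  assumes d: "d > 0" and R: "R \<subseteq> carrier (free_algebra S)"
    and \<phi>: "range \<phi> \<subseteq> blocks d" and zero: "\<And>r. r \<in> R \<Longrightarrow> ev \<phi> r = 0"
  shows "\<exists>\<rho>. representation (presented_algebra S R) d \<rho>"
proof -
  let ?F = "free_algebra S"
  interpret F: ring ?F by (rule ring_free_algebra)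
  define K where "K = {f \<in> carrier ?F. ev \<phi> f = 0}"
  have "subgroup K (add_monoid ?F)"
  proof (rule subgroup.intro)
    fix f assume f: "f \<in> K"
    then have "\<ominus>\<^bsub>?F\<^esub> f = - f"
      by (intro F.minus_equality) (auto simp: K_def free_algebra_carrierI)
    with f have "\<ominus>\<^bsub>?F\<^esub> f \<in> K"
      by (auto simp: K_def ev_simps free_algebra_carrierI)
    then show "inv\<^bsub>add_monoid ?F\<^esub> f \<in> K"
      unfolding a_inv_def .
  qed (auto simp: K_def ev_simps free_algebra_carrierI)
  then have "ideal K ?F"
    by (intro idealI F.ring_axioms) (auto simp: K_def ev_simps free_algebra_carrierI)
  moreover have "R \<subseteq> K" using R zero by (auto simp: K_def)
  ultimately have IK: "Idl\<^bsub>?F\<^esub> R \<subseteq> K"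
    by (rule F.genideal_minimal)
  define I where "I = Idl\<^bsub>?F\<^esub> R"
  have I: "ideal I ?F"
    unfolding I_def by (rule F.genideal_ideal[OF R])
  interpret ideal I ?F by (rule I)
  define \<rho> where "\<rho> C = block_of d (ev \<phi> (SOME f. f \<in> C))" for C
  have \<rho>: "\<rho> (I +>\<^bsub>?F\<^esub> f) = block_of d (ev \<phi> f)" if "f \<in> carrier ?F" for f
  proof -
    have "(SOME h. h \<in> I +>\<^bsub>?F\<^esub> f) \<in> I +>\<^bsub>?F\<^esub> f"
      by (rule someI) (rule a_rcos_self[OF that])
    then obtain i where "i \<in> I" "(SOME h. h \<in> I +>\<^bsub>?F\<^esub> f) = i + f"
      by (auto simp: a_r_coset_def')
    with IK show ?thesis
      by (auto simp: \<rho>_def I_def[symmetric] ev_simps K_def)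
  qed
  have coset: "\<exists>f\<in>carrier ?F. C = I +>\<^bsub>?F\<^esub> f" if "C \<in> carrier (?F Quot I)" for C
    using that by (auto simp: FactRing_def A_RCOSETS_def')
  note ev_blocks = ev_in_blocks[OF d \<phi>]
  have of_add: "block_of d (E + F) = block_of d E + block_of d F"
    and of_mult: "block_of d (E * F) = block_of d E * block_of d F"
    if "E \<in> blocks d" "F \<in> blocks d" for E F
    using that d
    by (auto simp: blocks_def block_of_block_op simp flip: block_op_add block_op_mult)
  have of_sc: "block_of d (sc a * E) = a \<cdot>\<^sub>m block_of d E" if "E \<in> blocks d" for E a
    using that d by (auto simp: blocks_def block_of_block_op simp flip: block_op_smult)
  have of_one: "block_of d 1 = 1\<^sub>m d"
    using block_of_block_op[of "1\<^sub>m d" d] d by (simp add: block_op_one)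
  have hom: "\<rho> \<in> ring_hom (?F Quot I) (Mat d)"
  proof (rule ring_hom_memI)
    fix C assume "C \<in> carrier (?F Quot I)"
    then show "\<rho> C \<in> carrier (Mat d)"
      by (simp add: \<rho>_def ring_mat_def)
  next
    fix C C' assume "C \<in> carrier (?F Quot I)" "C' \<in> carrier (?F Quot I)"
    then obtain f h where fh: "f \<in> carrier ?F" "h \<in> carrier ?F"
      "C = I +>\<^bsub>?F\<^esub> f" "C' = I +>\<^bsub>?F\<^esub> h"
      using coset by metis
    have "C \<otimes>\<^bsub>?F Quot I\<^esub> C' = I +>\<^bsub>?F\<^esub> (f * h)"
      using rcoset_mult_add[OF fh(1,2)] fh by (simp add: FactRing_def)
    then show "\<rho> (C \<otimes>\<^bsub>?F Quot I\<^esub> C') = \<rho> C \<otimes>\<^bsub>Mat d\<^esub> \<rho> C'"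
      using fh by (simp add: \<rho> free_algebra_carrierI ring_mat_def ev_mult of_mult ev_blocks)
    have "C \<oplus>\<^bsub>?F Quot I\<^esub> C' = I +>\<^bsub>?F\<^esub> (f + h)"
      using a_rcos_sum[OF fh(1,2)] fh by (simp add: FactRing_def)
    then show "\<rho> (C \<oplus>\<^bsub>?F Quot I\<^esub> C') = \<rho> C \<oplus>\<^bsub>Mat d\<^esub> \<rho> C'"
      using fh by (simp add: \<rho> free_algebra_carrierI ring_mat_def ev_add of_add ev_blocks)
  next
    show "\<rho> \<one>\<^bsub>?F Quot I\<^esub> = \<one>\<^bsub>Mat d\<^esub>"
      using \<rho>[of 1] by (simp add: FactRing_def free_algebra_carrierI ring_mat_def of_one)
  qed
  have "\<rho> (a \<odot>\<^bsub>quot_algebra ?F I\<^esub> C) = a \<cdot>\<^sub>m \<rho> C" if "C \<in> carrier (?F Quot I)" for a C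
    using coset[OF that] quot_algebra_smult_coset[OF I]
    by (auto simp: \<rho> free_algebra_carrierI ev_mult of_sc ev_blocks)
  with hom show ?thesis
    unfolding representation_def presented_algebra_def I_def[symmetric] ring_hom_quot_algebra
    by auto
qed

section \<open>Signs of inversions\<close>

text \<open>The sign of exchanging two neighbouring factors of an exterior or Clifford monomial: \<open>s\<close> and \<open>t\<close> record
  whether the factors are present (\<open>- 1\<close>) or absent (\<open>1\<close>).\<close>

definition pair_sign :: "complex \<Rightarrow> complex \<Rightarrow> complex" where
  "pair_sign s t = (if s = -1 \<and> t = -1 then -1 else 1)"

text \<open>The sign by which \<open>e\<^sub>k \<mapsto> e\<^bsub>\<pi>(k)\<^esub>\<close> carries the increasing product of the \<open>e\<^sub>k\<close> with \<open>\<chi>\<^sub>k = -1\<close> to the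
  increasing product of their images.\<close>

definition inversion_sign :: "nat \<Rightarrow> (nat \<Rightarrow> nat) \<Rightarrow> (nat \<Rightarrow> complex) \<Rightarrow> complex" where
  "inversion_sign n \<pi> \<chi> =
     (\<Prod>a<n. \<Prod>b<n. if a < b \<and> \<pi> b < \<pi> a then pair_sign (\<chi> a) (\<chi> b) else 1)"

lemma pair_sign_commute: "pair_sign s t = pair_sign t s"
  by (auto simp: pair_sign_def)

lemma pair_sign_square: "pair_sign s t * pair_sign s t = 1"
  by (auto simp: pair_sign_def)

lemma prod_lessThan_permute:
  fixes f :: "nat \<Rightarrow> complex"
  assumes "\<rho> permutes {..<n}"
  shows "(\<Prod>k<n. f (\<rho> k)) = (\<Prod>k<n. f k)"
  using prod.permute[OF assms, of f] by (simp add: o_def)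

lemma prod_pairs_symmetrize:
  fixes f :: "nat \<Rightarrow> nat \<Rightarrow> complex"
  assumes "\<And>a. a < n \<Longrightarrow> f a a = 1"
  shows "(\<Prod>a<n. \<Prod>b<n. f a b) = (\<Prod>a<n. \<Prod>b<n. if a < b then f a b * f b a else 1)"
proof -
  have "(\<Prod>a<n. \<Prod>b<n. f a b) =
      (\<Prod>a<n. \<Prod>b<n. (if a < b then f a b else 1) * (if b < a then f a b else 1))"
    using assms by (intro prod.cong) auto
  also have "\<dots> = (\<Prod>a<n. \<Prod>b<n. if a < b then f a b else 1) *
      (\<Prod>a<n. \<Prod>b<n. if b < a then f a b else 1)"
    by (simp add: prod.distrib)
  also have "(\<Prod>a<n. \<Prod>b<n. if b < a then f a b else 1) =
      (\<Prod>a<n. \<Prod>b<n. if a < b then f b a else 1)"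
    by (rule prod.swap)
  also have "(\<Prod>a<n. \<Prod>b<n. if a < b then f a b else 1) * \<dots> =
      (\<Prod>a<n. \<Prod>b<n. if a < b then f a b * f b a else 1)"
    unfolding prod.distrib[symmetric] by (intro prod.cong) auto
  finally show ?thesis .
qed

text \<open>The cocycle identity of the signs. It is checked pair by pair: \<open>\<pi> \<circ> \<rho>\<close> inverts a pair exactly if one of
  \<open>\<rho>\<close> (on the pair) and \<open>\<pi>\<close> (on its image) does. As \<open>\<rho>\<close> may reverse the order of a pair, the ordered
  pairs are first symmetrized.\<close>

lemma inversion_sign_compose:
  assumes \<pi>: "\<pi> permutes {..<n}" and \<rho>: "\<rho> permutes {..<n}"
  shows "inversion_sign n \<pi> (\<chi> \<circ> inv_into UNIV \<rho>) * inversion_sign n \<rho> \<chi> = inversion_sign n (\<pi> \<circ> \<rho>) \<chi>"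
proof -
  have inj: "\<rho> a = \<rho> b \<longleftrightarrow> a = b" "\<pi> a = \<pi> b \<longleftrightarrow> a = b" for a b
    using permutes_inj[OF \<rho>] permutes_inj[OF \<pi>] by (auto dest: injD)
  let ?c = "\<lambda>a b. pair_sign (\<chi> a) (\<chi> b)"
  have "inversion_sign n \<pi> (\<chi> \<circ> inv_into UNIV \<rho>) =
      (\<Prod>a<n. \<Prod>b<n. if \<rho> a < \<rho> b \<and> \<pi> (\<rho> b) < \<pi> (\<rho> a) then ?c a b else 1)"
    unfolding inversion_sign_def
    by (subst (1 2) prod_lessThan_permute[OF \<rho>, symmetric])
       (simp add: permutes_inverses(2)[OF \<rho>] cong: if_cong)
  also have "\<dots> = (\<Prod>a<n. \<Prod>b<n. if a < b then
      (if \<rho> a < \<rho> b \<and> \<pi> (\<rho> b) < \<pi> (\<rho> a) then ?c a b else 1) *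
      (if \<rho> b < \<rho> a \<and> \<pi> (\<rho> a) < \<pi> (\<rho> b) then ?c b a else 1) else 1)"
    by (rule prod_pairs_symmetrize) simp
  finally have 1: "inversion_sign n \<pi> (\<chi> \<circ> inv_into UNIV \<rho>) = \<dots>" .
  show ?thesis
    unfolding 1 unfolding inversion_sign_def prod.distrib[symmetric]
  proof (intro prod.cong refl, goal_cases)
    case (1 a b)
    have "\<rho> a < \<rho> b \<or> \<rho> b < \<rho> a" "\<pi> (\<rho> a) < \<pi> (\<rho> b) \<or> \<pi> (\<rho> b) < \<pi> (\<rho> a)" if "a < b"
      using that inj by (metis nat_neq_iff)+
    then show ?case
      by (auto simp: pair_sign_commute[of "\<chi> b"] pair_sign_square)
  qed
qed

text \<open>Compatibility of the signs with left multiplication by \<open>e\<^sub>i\<close>: sorting \<open>e\<^sub>i\<close> in and then permuting agrees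
  with permuting and then sorting \<open>e\<^bsub>\<pi>(i)\<^esub>\<close> in. Flipping \<open>\<chi>\<^sub>i\<close> changes the factor of each inverted pair
  \<open>{i, b}\<close> by \<open>\<chi>\<^sub>b\<close>; these are the indices \<open>b\<close> that lie on different sides of \<open>i\<close> before and after \<open>\<pi>\<close>.\<close>

lemma inversion_sign_flip:
  assumes \<pi>: "\<pi> permutes {..<n}" and i: "i < n"
    and \<chi>: "\<And>k. k < n \<Longrightarrow> \<chi> k = 1 \<or> \<chi> k = -1"
  shows "(\<Prod>k<i. \<chi> k) * inversion_sign n \<pi> (\<chi>(i := - \<chi> i)) =
    inversion_sign n \<pi> \<chi> * (\<Prod>k<\<pi> i. \<chi> (inv_into UNIV \<pi> k))"
proof -
  have inj: "\<pi> a = \<pi> b \<longleftrightarrow> a = b" for a b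
    using permutes_inj[OF \<pi>] by (auto dest: injD)
  have \<pi>i: "\<pi> i < n" using permutes_in_image[OF \<pi>, of i] i by simp
  let ?I = "\<lambda>a b. a < b \<and> \<pi> b < \<pi> a"
  \<comment> \<open>Each factor of an inverted pair \<open>{i, b}\<close> changes by \<open>\<chi>\<^sub>b\<close>.\<close>
  have "inversion_sign n \<pi> (\<chi>(i := - \<chi> i)) =
      (\<Prod>a<n. \<Prod>b<n. (if ?I a b then pair_sign (\<chi> a) (\<chi> b) else 1) *
        ((if a = i then if ?I i b then \<chi> b else 1 else 1) *
         (if b = i then if ?I a i then \<chi> a else 1 else 1)))"
    unfolding inversion_sign_def
  proof (intro prod.cong refl, goal_cases)
    case (1 a b)
    with \<chi>[of a] \<chi>[of b] show ?case by (auto simp: pair_sign_def)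
  qed
  also have "\<dots> = inversion_sign n \<pi> \<chi> *
      ((\<Prod>b<n. if ?I i b then \<chi> b else 1) * (\<Prod>a<n. if ?I a i then \<chi> a else 1))"
  proof -
    have "(\<Prod>a<n. \<Prod>b<n. if a = i then if ?I i b then \<chi> b else 1 else 1) =
        (\<Prod>a<n. if a = i then \<Prod>b<n. if ?I i b then \<chi> b else 1 else 1)"
      by (intro prod.cong) auto
    also have "\<dots> = (\<Prod>b<n. if ?I i b then \<chi> b else 1)"
      using i by (subst prod.delta) auto
    finally have 1: "(\<Prod>a<n. \<Prod>b<n. if a = i then if ?I i b then \<chi> b else 1 else 1) = \<dots>" .
    have 2: "(\<Prod>a<n. \<Prod>b<n. if b = i then if ?I a i then \<chi> a else 1 else 1) =
        (\<Prod>a<n. if ?I a i then \<chi> a else 1)"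
      using i by (subst prod.delta) auto
    show ?thesis unfolding inversion_sign_def prod.distrib 1 2 ..
  qed
  finally have 1: "inversion_sign n \<pi> (\<chi>(i := - \<chi> i)) = \<dots>" .
  have 2: "(\<Prod>k<i. \<chi> k) = (\<Prod>b<n. if b < i then \<chi> b else 1)"
    using i by (subst prod.inter_filter[symmetric]) (auto intro!: prod.cong)
  have "(\<Prod>k<\<pi> i. \<chi> (inv_into UNIV \<pi> k)) = (\<Prod>k<n. if k < \<pi> i then \<chi> (inv_into UNIV \<pi> k) else 1)"
    using \<pi>i by (subst prod.inter_filter[symmetric]) (auto intro!: prod.cong)
  also have "\<dots> = (\<Prod>b<n. if \<pi> b < \<pi> i then \<chi> b else 1)"
    by (subst prod_lessThan_permute[OF \<pi>, symmetric]) (simp add: permutes_inverses(2)[OF \<pi>] cong: if_cong)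
  also have "\<dots> = (\<Prod>b<n. if b < i then \<chi> b else 1) *
      ((\<Prod>b<n. if ?I i b then \<chi> b else 1) * (\<Prod>a<n. if ?I a i then \<chi> a else 1))"
    unfolding prod.distrib[symmetric]
  proof (intro prod.cong refl, goal_cases)
    case (1 b)
    consider "b = i" | "b < i" "\<pi> b < \<pi> i" | "b < i" "\<pi> i < \<pi> b"
      | "i < b" "\<pi> b < \<pi> i" | "i < b" "\<pi> i < \<pi> b"
      using inj[of b i] by (metis nat_neq_iff)
    then show ?case using \<chi>[of b] 1 by cases auto
  qed
  finally show ?thesis unfolding 1 2 by (simp add: mult_ac)
qed

text \<open>The inversions of the transposition \<open>(i j)\<close> are \<open>(i, j)\<close> and \<open>(i, k)\<close>, \<open>(k, j)\<close> for \<open>i < k < j\<close>. The last two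
  cancel if \<open>\<chi>\<^sub>i = \<chi>\<^sub>j\<close> and contribute \<open>\<chi>\<^sub>k\<close> otherwise.\<close>

lemma inversion_sign_swap_less:
  assumes ij: "i < j" "j < n" and \<chi>: "\<And>k. k < n \<Longrightarrow> \<chi> k = 1 \<or> \<chi> k = -1"
  shows "\<chi> j * inversion_sign n (Transposition.transpose i j) \<chi> =
    ((1 + \<chi> i * \<chi> j) - (1 - \<chi> i * \<chi> j) * ((\<Prod>k<i. \<chi> k) * (\<Prod>k<j. \<chi> k))) / 2"
proof -
  let ?\<tau> = "Transposition.transpose i j"
  let ?B = "\<lambda>k. i < k \<and> k < j"
  have "inversion_sign n ?\<tau> \<chi> =
      (\<Prod>a<n. \<Prod>b<n. (if a = i then if ?B b then pair_sign (\<chi> i) (\<chi> b) else 1 else 1) *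
        ((if b = j then if ?B a then pair_sign (\<chi> a) (\<chi> j) else 1 else 1) *
         (if a = i then if b = j then pair_sign (\<chi> i) (\<chi> j) else 1 else 1)))"
    unfolding inversion_sign_def
  proof (intro prod.cong refl, goal_cases)
    case (1 a b)
    then show ?case using ij by (auto simp: transpose_def)
  qed
  also have "\<dots> = (\<Prod>b<n. if ?B b then pair_sign (\<chi> i) (\<chi> b) else 1) *
      ((\<Prod>a<n. if ?B a then pair_sign (\<chi> a) (\<chi> j) else 1) * pair_sign (\<chi> i) (\<chi> j))"
  proof -
    have row: "(\<Prod>a<n. \<Prod>b<n. if a = i then f b else 1) = (\<Prod>b<n. f b)" for f :: "nat \<Rightarrow> complex"
    proof -
      have "(\<Prod>a<n. \<Prod>b<n. if a = i then f b else 1) = (\<Prod>a<n. if a = i then \<Prod>b<n. f b else 1)"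
        by (intro prod.cong) auto
      then show ?thesis using ij by (simp add: prod.delta)
    qed
    have col: "(\<Prod>b<n. if b = j then f else 1) = f" for f :: complex
      using ij by (simp add: prod.delta)
    show ?thesis unfolding prod.distrib row col ..
  qed
  also have "\<dots> = (\<Prod>k<n. if ?B k then if \<chi> i = \<chi> j then 1 else \<chi> k else 1) * pair_sign (\<chi> i) (\<chi> j)"
    unfolding mult.assoc[symmetric] prod.distrib[symmetric]
  proof (intro arg_cong2[where f = "(*)"] prod.cong refl, goal_cases)
    case (1 k)
    with \<chi>[of k] \<chi>[of i] \<chi>[of j] ij show ?case by (auto simp: pair_sign_def)
  qed
  also have "\<dots> = (if \<chi> i = \<chi> j then 1 else \<Prod>k<n. if ?B k then \<chi> k else 1) * pair_sign (\<chi> i) (\<chi> j)"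
    by (auto cong: if_cong)
  finally have 1: "inversion_sign n ?\<tau> \<chi> = \<dots>" .
  have below: "(\<Prod>k<l. \<chi> k) = (\<Prod>b<n. if b < l then \<chi> b else 1)" if "l < n" for l
    using that by (subst prod.inter_filter[symmetric]) (auto intro!: prod.cong)
  have "(\<Prod>k<i. \<chi> k) * (\<Prod>k<j. \<chi> k) =
      (\<Prod>k<n. (if k = i then \<chi> k else 1) * (if ?B k then \<chi> k else 1))"
    using ij below[of i] below[of j] unfolding prod.distrib[symmetric]
  proof (simp add: prod.distrib[symmetric], intro prod.cong refl, goal_cases)
    case (1 k)
    with \<chi>[of k] ij show ?case by (auto simp: not_less)
  qed
  also have "\<dots> = \<chi> i * (\<Prod>k<n. if ?B k then \<chi> k else 1)"
    using ij by (simp add: prod.distrib prod.delta)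
  finally have 2: "(\<Prod>k<i. \<chi> k) * (\<Prod>k<j. \<chi> k) = \<dots>" .
  show ?thesis
    unfolding 1 2 using \<chi>[of i] \<chi>[of j] ij by (auto simp: pair_sign_def)
qed

lemma inversion_sign_swap:
  assumes ij: "i < n" "j < n" "i \<noteq> j" and \<chi>: "\<And>k. k < n \<Longrightarrow> \<chi> k = 1 \<or> \<chi> k = -1"
  shows "\<chi> j * inversion_sign n (Transposition.transpose i j) \<chi> =
    ((1 + \<chi> i * \<chi> j) - (if j < i then -1 else 1) *
      ((1 - \<chi> i * \<chi> j) * ((\<Prod>k<i. \<chi> k) * (\<Prod>k<j. \<chi> k)))) / 2"
proof (cases "i < j")
  case True
  then show ?thesis using inversion_sign_swap_less[of i j n \<chi>] ij \<chi> by simp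
next
  case False
  then have "\<chi> i * inversion_sign n (Transposition.transpose i j) \<chi> =
      ((1 + \<chi> i * \<chi> j) - (1 - \<chi> i * \<chi> j) * ((\<Prod>k<i. \<chi> k) * (\<Prod>k<j. \<chi> k))) / 2"
    using inversion_sign_swap_less[of j i n \<chi>] ij \<chi> by (simp add: transpose_commute mult_ac)
  then show ?thesis
    using False ij \<chi>[of i] \<chi>[of j] by (auto simp: field_simps)
qed

section \<open>Twisting a representation of the group\<close>

text \<open>A separate symbol for the action of scalars: the rules \<open>scale_simps\<close> move scalars to the front of a
  product and merge them, which terminates as a rewrite system, unlike commuting central elements.\<close>

definition scale :: "complex \<Rightarrow> 'a \<Rightarrow> 'a::complex_algebra_1" (infixr "\<star>" 75) where
  "a \<star> x = sc a * x"

lemma scale_simps: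
  "x * (a \<star> y) = a \<star> (x * y)" "(a \<star> x) * y = a \<star> (x * y)" "a \<star> (b \<star> x) = (a * b) \<star> x"
  by (simp_all add: scale_def mult.assoc sc_mult) (metis mult.assoc sc_commute)

lemma scale_1 [simp]: "1 \<star> x = x" "(- 1) \<star> x = - x" "0 \<star> x = 0" "a \<star> 0 = 0"
  by (simp_all add: scale_def sc_minus)

lemma scale_minus: "a \<star> (- x) = - (a \<star> x)" "(- a) \<star> x = - (a \<star> x)"
  by (simp_all add: scale_def sc_minus)

lemma scale_add: "a \<star> (x + y) = a \<star> x + a \<star> y" "a \<star> (x - y) = a \<star> x - a \<star> y"
  "(a + b) \<star> x = a \<star> x + b \<star> x" "(a - b) \<star> x = a \<star> x - b \<star> x"
  for x :: "'a::complex_algebra_1"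
proof -
  have "sc (a - b) = (sc a - sc b :: 'a)"
    using sc_add[of a "- b"] by (simp add: sc_minus)
  then show "(a - b) \<star> x = a \<star> x - b \<star> x"
    by (simp add: scale_def left_diff_distrib)
qed (simp_all add: scale_def distrib_left distrib_right right_diff_distrib sc_add)

lemma scale_sum: "a \<star> sum f A = (\<Sum>k\<in>A. a \<star> f k)"
  by (simp add: scale_def sum_distrib_left)

lemma scale_double: "a \<star> x + a \<star> x = (2 * a) \<star> x"
  by (simp flip: scale_add(3))

text \<open>A column of a monomial matrix with nonzero coefficients has exactly one nonzero entry, so the choice recovers
  the permutation from the matrix.\<close>

definition mat_perm :: "nat \<Rightarrow> complex mat \<Rightarrow> nat \<Rightarrow> nat" where
  "mat_perm n g k = (SOME r. r < n \<and> g $$ (r, k) \<noteq> 0)"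

lemma mat_perm_mon:
  assumes "\<pi> permutes {..<n}" "k < n" "a k \<noteq> 0"
  shows "mat_perm n (mon n a \<pi>) k = \<pi> k"
  unfolding mat_perm_def
proof (rule some_equality)
  have "\<pi> k < n" using permutes_in_image[OF assms(1), of k] assms by simp
  then show "\<pi> k < n \<and> mon n a \<pi> $$ (\<pi> k, k) \<noteq> 0"
    using assms by (simp add: mon_index)
  show "r = \<pi> k" if "r < n \<and> mon n a \<pi> $$ (r, k) \<noteq> 0" for r
    using that assms by (auto simp: mon_index split: if_splits)
qed

locale G_representation =
  fixes m p n :: nat and D :: "complex mat \<Rightarrow> 'a::complex_algebra_1"
  assumes m: "m > 0" and p: "p dvd m" and even_quot: "even (m div p)"
    and D_one: "D (1\<^sub>m n) = 1"
    and D_mult: "\<And>g h. g \<in> G_group m p n \<Longrightarrow> h \<in> G_group m p n \<Longrightarrow> D (g * h) = D g * D h"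
begin

abbreviation G where "G \<equiv> G_group m p n"

definition \<tau> :: "nat \<Rightarrow> 'a" where
  "\<tau> k = D (t_elt n k (-1))"

definition \<Gamma> :: "nat \<Rightarrow> 'a" where
  "\<Gamma> i = prod_list (map \<tau> [0..<i])"

text \<open>The operator that is \<open>- 1\<close> on the common \<open>- 1\<close>-eigenspace of \<open>\<tau>\<^sub>a\<close> and \<open>\<tau>\<^sub>b\<close>, and \<open>1\<close> on the other eigenspaces
  (a controlled sign change).\<close>

definition CZ :: "nat \<Rightarrow> nat \<Rightarrow> 'a" where
  "CZ a b = (1 / 2) \<star> (1 + \<tau> a + \<tau> b - \<tau> a * \<tau> b)"

text \<open>The operator form of \<open>inversion_sign\<close>: see \<open>weight_\<Theta>\<close>.\<close>

definition \<Theta> :: "(nat \<Rightarrow> nat) \<Rightarrow> 'a" where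
  "\<Theta> \<pi> = prod_list (map (\<lambda>a.
     prod_list (map (\<lambda>b. if a < b \<and> \<pi> b < \<pi> a then CZ a b else 1) [0..<n])) [0..<n])"

lemma sign_mem_G: "k < n \<Longrightarrow> t_elt n k (-1) \<in> G"
  using even_quot p by (intro t_elt_in_G) (auto simp: roots_def)

lemma mon_G_nonzero:
  assumes "\<pi> permutes {..<n}" "mon n a \<pi> \<in> G" "k < n"
  shows "a k \<noteq> 0"
proof -
  obtain \<pi>' b where b: "\<pi>' permutes {..<n}" "mon n a \<pi> = mon n b \<pi>'" "\<forall>k<n. b k ^ m = 1"
    using assms(2) unfolding G_group_iff by blast
  have "\<pi>' k < n" using permutes_in_image[OF b(1), of k] assms by simp
  then have "mon n a \<pi> $$ (\<pi>' k, k) = b k"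
    using b assms by (simp add: mon_index)
  moreover have "b k \<noteq> 0" using b(3) assms(3) m by (metis power_eq_0_iff zero_neq_one)
  ultimately show ?thesis
    using \<open>\<pi>' k < n\<close> assms(3) by (auto simp: mon_index split: if_splits)
qed

lemma \<tau>_square: "k < n \<Longrightarrow> \<tau> k * \<tau> k = 1"
proof -
  assume k: "k < n"
  have "t_elt n k (-1) * t_elt n k (-1) = 1\<^sub>m n"
    unfolding t_elt_mon mon_one mon_mult[OF permutes_id] by (auto intro!: mon_cong)
  then show ?thesis
    unfolding \<tau>_def by (simp add: D_one k sign_mem_G flip: D_mult)
qed

lemma D_\<tau>:
  assumes \<pi>: "\<pi> permutes {..<n}" and g: "mon n a \<pi> \<in> G" and k: "k < n"
  shows "D (mon n a \<pi>) * \<tau> k = \<tau> (\<pi> k) * D (mon n a \<pi>)"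
proof -
  have \<pi>k: "\<pi> k < n" using permutes_in_image[OF \<pi>, of k] k by simp
  have inj: "\<pi> a = \<pi> b \<longleftrightarrow> a = b" for a b
    using permutes_inj[OF \<pi>] by (auto dest: injD)
  have "mon n a \<pi> * t_elt n k (-1) = t_elt n (\<pi> k) (-1) * mon n a \<pi>"
    unfolding t_elt_mon mon_mult[OF permutes_id] mon_mult[OF \<pi>] by (auto simp: inj intro!: mon_cong)
  then show ?thesis
    unfolding \<tau>_def by (simp add: g k \<pi>k sign_mem_G flip: D_mult)
qed

lemma \<tau>_commute: "j < n \<Longrightarrow> k < n \<Longrightarrow> \<tau> j * \<tau> k = \<tau> k * \<tau> j"
  using D_\<tau>[OF permutes_id, of "\<lambda>l. if l = j then -1 else 1" k] sign_mem_G[of j]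
  by (simp add: \<tau>_def t_elt_mon)

text \<open>Elements of the algebra play the role of vectors, on which the algebra acts by left multiplication;
  \<open>weight\<close> describes the joint eigenvectors of the involutions.\<close>

definition weight :: "(nat \<Rightarrow> complex) \<Rightarrow> 'a \<Rightarrow> bool" where
  "weight \<chi> v \<longleftrightarrow> (\<forall>k<n. (\<chi> k = 1 \<or> \<chi> k = -1) \<and> \<tau> k * v = \<chi> k \<star> v)"

lemma weight_sign: "weight \<chi> v \<Longrightarrow> k < n \<Longrightarrow> \<chi> k = 1 \<or> \<chi> k = -1"
  and weight_\<tau>: "weight \<chi> v \<Longrightarrow> k < n \<Longrightarrow> \<tau> k * v = \<chi> k \<star> v"
  by (simp_all add: weight_def)

text \<open>The unit is a sum of joint eigenvectors, since \<open>v = (v + \<tau> v) / 2 + (v - \<tau> v) / 2\<close> for an involution \<open>\<tau>\<close>.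
  The induction splits off one involution at a time, from the last to the first.\<close>

lemma eq_on_weight_vectors:
  assumes "\<And>\<chi> v. weight \<chi> v \<Longrightarrow> A * v = B * v"
  shows "A = B"
proof -
  have "A * v = B * v" if "j \<le> n" "\<forall>k<j. (\<chi> k = 1 \<or> \<chi> k = -1) \<and> \<tau> k * v = \<chi> k \<star> v" for j \<chi> v
    using that
  proof (induction j arbitrary: \<chi> v rule: inc_induct)
    case base
    then show ?case using assms by (simp add: weight_def)
  next
    case (step j)
    \<comment> \<open>The vector \<open>v + s \<tau>\<^sub>j v\<close> is an eigenvector of \<open>\<tau>\<^sub>j\<close> for the eigenvalue \<open>s\<close>.\<close>
    have part: "A * (v + s \<star> (\<tau> j * v)) = B * (v + s \<star> (\<tau> j * v))" if s: "s = 1 \<or> s = -1" for s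
    proof (rule step.IH[of "\<chi>(j := s)"], intro allI impI conjI)
      fix k assume k: "k < Suc j"
      then show "(\<chi>(j := s)) k = 1 \<or> (\<chi>(j := s)) k = -1"
        using s step.prems by (cases "k = j") auto
      show "\<tau> k * (v + s \<star> (\<tau> j * v)) = (\<chi>(j := s)) k \<star> (v + s \<star> (\<tau> j * v))"
      proof (cases "k = j")
        case True
        have "\<tau> j * (\<tau> j * v) = v"
          using step.hyps by (simp add: \<tau>_square flip: mult.assoc)
        then show ?thesis using True s by (auto simp: distrib_left scale_simps scale_minus algebra_simps)
      next
        case False
        then have "k < j" "k < n" using k step.hyps by auto
        then have "\<tau> k * v = \<chi> k \<star> v" "\<tau> k * (\<tau> j * v) = \<chi> k \<star> (\<tau> j * v)"
          using step.prems step.hyps \<tau>_commute[of k j] by (auto simp: scale_simps mult.assoc[symmetric])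
            (metis mult.assoc scale_simps(1))
        then show ?thesis using False by (simp add: distrib_left scale_simps scale_add mult.commute)
      qed
    qed
    have v: "v = (1 / 2) \<star> ((v + 1 \<star> (\<tau> j * v)) + (v + (-1) \<star> (\<tau> j * v)))"
      by (simp add: scale_add scale_minus scale_double)
    have split: "C * v = (1 / 2) \<star> (C * (v + 1 \<star> (\<tau> j * v)) + C * (v + (-1) \<star> (\<tau> j * v)))" for C
      by (subst (1) v) (simp only: scale_simps(1) distrib_left[of C "v + 1 \<star> (\<tau> j * v)"])
    show ?case
      by (simp only: split[of A] split[of B] part[OF disjI1[OF refl]] part[OF disjI2[OF refl]])
  qed
  from this[of 0 _ 1] show ?thesis by simp
qed

text \<open>Products of operators are products of lists, as the factors need not commute; their eigenvalues do.\<close>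

lemma prod_list_upt: "prod_list (map f [0..<l]) = (\<Prod>k<l. f k :: complex)"
  using prod.distinct_set_conv_list[of "[0..<l]" f] by (simp add: atLeast0LessThan)

lemma prod_list_eigen:
  assumes "\<And>k. k \<in> set ks \<Longrightarrow> F k * v = f k \<star> v"
  shows "prod_list (map F ks) * v = prod_list (map f ks) \<star> v"
  using assms by (induction ks) (auto simp: mult.assoc scale_simps mult.commute)

lemma weight_\<Gamma>:
  assumes "weight \<chi> v" "i \<le> n"
  shows "\<Gamma> i * v = (\<Prod>k<i. \<chi> k) \<star> v"
proof -
  have "\<Gamma> i * v = prod_list (map \<chi> [0..<i]) \<star> v"
    unfolding \<Gamma>_def using assms by (intro prod_list_eigen weight_\<tau>) auto
  then show ?thesis by (simp add: prod_list_upt)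
qed

lemma weight_CZ:
  assumes "weight \<chi> v" "a < n" "b < n"
  shows "CZ a b * v = pair_sign (\<chi> a) (\<chi> b) \<star> v"
proof -
  note [simp] = weight_\<tau>[OF assms(1)]
  have "CZ a b * v = (1 / 2) \<star> (1 \<star> v + \<chi> a \<star> v + \<chi> b \<star> v - (\<chi> a * \<chi> b) \<star> v)"
    using assms by (simp add: CZ_def scale_simps distrib_right left_diff_distrib mult.assoc mult.commute)
  also have "\<dots> = ((1 + \<chi> a + \<chi> b - \<chi> a * \<chi> b) / 2) \<star> v"
    by (simp only: scale_add(3,4)[symmetric] scale_simps) simp
  also have "(1 + \<chi> a + \<chi> b - \<chi> a * \<chi> b) / 2 = pair_sign (\<chi> a) (\<chi> b)"
    using weight_sign[OF assms(1,2)] weight_sign[OF assms(1,3)] by (auto simp: pair_sign_def)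
  finally show ?thesis .
qed

lemma weight_\<Theta>:
  assumes "weight \<chi> v"
  shows "\<Theta> \<pi> * v = inversion_sign n \<pi> \<chi> \<star> v"
proof -
  let ?I = "\<lambda>a b. a < b \<and> \<pi> b < \<pi> a"
  have "prod_list (map (\<lambda>b. if ?I a b then CZ a b else 1) [0..<n]) * v =
      prod_list (map (\<lambda>b. if ?I a b then pair_sign (\<chi> a) (\<chi> b) else 1) [0..<n]) \<star> v" if "a < n" for a
    by (rule prod_list_eigen) (use that weight_CZ[OF assms] in auto)
  then have "\<Theta> \<pi> * v = prod_list (map (\<lambda>a.
      prod_list (map (\<lambda>b. if ?I a b then pair_sign (\<chi> a) (\<chi> b) else 1) [0..<n])) [0..<n]) \<star> v"
    unfolding \<Theta>_def by (rule prod_list_eigen) simp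
  then show ?thesis
    unfolding prod_list_upt inversion_sign_def .
qed

lemma weight_D:
  assumes v: "weight \<chi> v" and \<pi>: "\<pi> permutes {..<n}" and g: "mon n a \<pi> \<in> G"
  shows "weight (\<chi> \<circ> inv_into UNIV \<pi>) (D (mon n a \<pi>) * v)"
  unfolding weight_def
proof (intro allI impI conjI)
  fix k assume "k < n"
  then have k: "inv_into UNIV \<pi> k < n"
    using permutes_in_image[OF permutes_inv[OF \<pi>], of k] by simp
  show "(\<chi> \<circ> inv_into UNIV \<pi>) k = 1 \<or> (\<chi> \<circ> inv_into UNIV \<pi>) k = -1"
    using weight_sign[OF v k] by simp
  have "\<tau> k * D (mon n a \<pi>) = D (mon n a \<pi>) * \<tau> (inv_into UNIV \<pi> k)"
    using D_\<tau>[OF \<pi> g k] by (simp add: permutes_inverses[OF \<pi>])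
  then show "\<tau> k * (D (mon n a \<pi>) * v) = (\<chi> \<circ> inv_into UNIV \<pi>) k \<star> (D (mon n a \<pi>) * v)"
    by (simp add: mult.assoc[symmetric]) (simp add: mult.assoc weight_\<tau>[OF v k] scale_simps)
qed

text \<open>The twisted group action. On a joint eigenvector with signs \<open>\<chi>\<close> it is \<open>D\<close> times \<open>inversion_sign\<close>.\<close>

definition D' :: "complex mat \<Rightarrow> 'a" where
  "D' g = D g * \<Theta> (mat_perm n g)"

lemma \<Theta>_cong:
  assumes "\<And>k. k < n \<Longrightarrow> \<pi> k = \<rho> k"
  shows "\<Theta> \<pi> = \<Theta> \<rho>"
  unfolding \<Theta>_def using assms by (intro arg_cong[where f = prod_list] map_cong) auto

lemma \<Theta>_id: "\<Theta> id = 1"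
proof -
  have "prod_list (map (\<lambda>_. 1) xs) = (1 :: 'a)" for xs :: "nat list"
    by (induction xs) auto
  then show ?thesis by (simp add: \<Theta>_def cong: if_cong conj_cong)
qed

lemma D'_mon:
  assumes "\<pi> permutes {..<n}" "mon n a \<pi> \<in> G"
  shows "D' (mon n a \<pi>) = D (mon n a \<pi>) * \<Theta> \<pi>"
  unfolding D'_def using assms
  by (intro arg_cong2[where f = "(*)"] refl \<Theta>_cong mat_perm_mon mon_G_nonzero)

lemma D'_diagonal: "mon n a id \<in> G \<Longrightarrow> D' (mon n a id) = D (mon n a id)"
  by (simp add: D'_mon permutes_id \<Theta>_id)

lemma D'_one: "D' (1\<^sub>m n) = 1"
  using D'_diagonal[of "\<lambda>_. 1"] one_in_G[of n m p] by (simp add: mon_one D_one flip: mon_one)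

lemma weight_D':
  assumes "weight \<chi> v" "\<pi> permutes {..<n}" "mon n a \<pi> \<in> G"
  shows "D' (mon n a \<pi>) * v = inversion_sign n \<pi> \<chi> \<star> (D (mon n a \<pi>) * v)"
  using assms by (simp add: D'_mon mult.assoc weight_\<Theta> scale_simps)

text \<open>On a joint eigenvector with signs \<open>\<chi>\<close>, the factor \<open>D h\<close> moves the signs by the permutation of \<open>h\<close>, which is
  the shift of arguments in \<open>inversion_sign_compose\<close>.\<close>

lemma D'_mult:
  assumes g: "g \<in> G" and h: "h \<in> G"
  shows "D' (g * h) = D' g * D' h"
proof (rule eq_on_weight_vectors)
  fix \<chi> v assume v: "weight \<chi> v"
  obtain \<pi> a where \<pi>: "\<pi> permutes {..<n}" and ga: "g = mon n a \<pi>"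
    using g unfolding G_group_iff by blast
  obtain \<rho> b where \<rho>: "\<rho> permutes {..<n}" and hb: "h = mon n b \<rho>"
    using h unfolding G_group_iff by blast
  have gh: "g * h = mon n (\<lambda>k. b k * a (\<rho> k)) (\<pi> \<circ> \<rho>)"
    unfolding ga hb by (rule mon_mult[OF \<rho>])
  have "D' (g * h) * v = inversion_sign n (\<pi> \<circ> \<rho>) \<chi> \<star> (D (g * h) * v)"
    unfolding gh using G_mult[OF g h] by (intro weight_D' v permutes_compose \<pi> \<rho>) (simp add: gh)
  also have "\<dots> = (inversion_sign n \<rho> \<chi> * inversion_sign n \<pi> (\<chi> \<circ> inv_into UNIV \<rho>)) \<star> (D g * (D h * v))"
    by (simp add: D_mult g h mult.assoc inversion_sign_compose[OF \<pi> \<rho>, symmetric] mult.commute)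
  also have "\<dots> = inversion_sign n \<rho> \<chi> \<star> (D' g * (D h * v))"
    using weight_D'[OF weight_D[OF v \<rho>] \<pi>] g h unfolding ga hb by (simp add: scale_simps)
  also have "\<dots> = D' g * D' h * v"
    using weight_D'[OF v \<rho>] h unfolding hb by (simp add: mult.assoc scale_simps)
  finally show "D' (g * h) * v = D' g * D' h * v" .
qed

text \<open>The transformation law under the group that the \<open>X\<^sub>i\<close> obey with \<open>f\<close> the identity, and the \<open>Y\<^sub>i\<close> with \<open>f\<close> the
  inverse. Only the values of \<open>f\<close> at \<open>1\<close> and \<open>- 1\<close> enter the sign calculations, so both families are
  treated at once.\<close>

definition covariant :: "(complex \<Rightarrow> complex) \<Rightarrow> (nat \<Rightarrow> 'a) \<Rightarrow> bool" where
  "covariant f Z \<longleftrightarrow> f 1 = 1 \<and> f (-1) = -1 \<and> (\<forall>\<pi> a i. \<pi> permutes {..<n} \<longrightarrow> mon n a \<pi> \<in> G \<longrightarrow> i < n \<longrightarrow>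
     D (mon n a \<pi>) * Z i = f (a i) \<star> (Z (\<pi> i) * D (mon n a \<pi>)))"

lemma covariantD:
  "covariant f Z \<Longrightarrow> \<pi> permutes {..<n} \<Longrightarrow> mon n a \<pi> \<in> G \<Longrightarrow> i < n \<Longrightarrow>
     D (mon n a \<pi>) * Z i = f (a i) \<star> (Z (\<pi> i) * D (mon n a \<pi>))"
  unfolding covariant_def by blast

lemma \<tau>_covariant:
  assumes Z: "covariant f Z" and "k < n" "i < n"
  shows "\<tau> k * Z i = (if i = k then - 1 else 1) \<star> (Z i * \<tau> k)"
  using covariantD[OF Z permutes_id, of "\<lambda>l. if l = k then -1 else 1" i] assms sign_mem_G[of k]
  by (auto simp: \<tau>_def t_elt_mon covariant_def)

lemma weight_covariant:
  assumes Z: "covariant f Z" and i: "i < n" and v: "weight \<chi> v"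
  shows "weight (\<chi>(i := - \<chi> i)) (Z i * v)"
  unfolding weight_def
proof (intro allI impI conjI)
  fix k assume k: "k < n"
  show "(\<chi>(i := - \<chi> i)) k = 1 \<or> (\<chi>(i := - \<chi> i)) k = -1"
    using weight_sign[OF v k] by auto
  have "\<tau> k * (Z i * v) = (if i = k then - 1 else 1) \<star> (Z i * (\<tau> k * v))"
    using \<tau>_covariant[OF Z k i] by (simp only: mult.assoc[symmetric] scale_simps(2))
  also have "\<dots> = ((if i = k then - 1 else 1) * \<chi> k) \<star> (Z i * v)"
    by (simp only: weight_\<tau>[OF v k] scale_simps)
  also have "(if i = k then - 1 else 1) * \<chi> k = (\<chi>(i := - \<chi> i)) k"
    by simp
  finally show "\<tau> k * (Z i * v) = (\<chi>(i := - \<chi> i)) k \<star> (Z i * v)" .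
qed

lemma \<Gamma>_covariant:
  assumes Z: "covariant f Z" and ij: "i \<le> n" "j < n"
  shows "\<Gamma> i * Z j = (if j < i then - 1 else 1) \<star> (Z j * \<Gamma> i)"
  using ij(1)
proof (induction i)
  case (Suc i)
  then have i: "i < n" by simp
  have step: "\<Gamma> (Suc i) = \<Gamma> i * \<tau> i" by (simp add: \<Gamma>_def)
  have "\<Gamma> (Suc i) * Z j = \<Gamma> i * (\<tau> i * Z j)"
    by (simp only: step mult.assoc)
  also have "\<dots> = (if j = i then - 1 else 1) \<star> (\<Gamma> i * Z j * \<tau> i)"
    by (simp only: \<tau>_covariant[OF Z i ij(2)] scale_simps mult.assoc)
  also have "\<Gamma> i * Z j = (if j < i then - 1 else 1) \<star> (Z j * \<Gamma> i)"
    using Suc i by simp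
  also have "(if j = i then - 1 else 1) \<star> ((if j < i then - 1 else 1) \<star> (Z j * \<Gamma> i) * \<tau> i) =
      ((if j = i then - 1 else 1) * (if j < i then - 1 else 1)) \<star> (Z j * \<Gamma> (Suc i))"
    by (simp only: step scale_simps mult.assoc)
  also have "(if j = i then - 1 else 1) * (if j < i then - 1 else 1) = (if j < Suc i then - 1 else 1 :: complex)"
    by auto
  finally show ?case .
qed (simp add: \<Gamma>_def)

lemma \<Gamma>_square: "i \<le> n \<Longrightarrow> \<Gamma> i * \<Gamma> i = 1"
proof (rule eq_on_weight_vectors)
  fix \<chi> v assume i: "i \<le> n" and v: "weight \<chi> v"
  have "(\<Prod>k<i. \<chi> k) * (\<Prod>k<i. \<chi> k) = 1"
    unfolding prod.distrib[symmetric]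
  proof (intro prod.neutral ballI)
    fix k assume "k \<in> {..<i}"
    then show "\<chi> k * \<chi> k = 1" using weight_sign[OF v, of k] i by auto
  qed
  then show "\<Gamma> i * \<Gamma> i * v = 1 * v"
    using i v by (simp add: mult.assoc weight_\<Gamma> scale_simps)
qed

lemma \<Gamma>_commute: "i \<le> n \<Longrightarrow> j \<le> n \<Longrightarrow> \<Gamma> i * \<Gamma> j = \<Gamma> j * \<Gamma> i"
proof (rule eq_on_weight_vectors)
  fix \<chi> v assume ij: "i \<le> n" "j \<le> n" and v: "weight \<chi> v"
  have "\<Gamma> i * \<Gamma> j * v = (prod \<chi> {..<j} * prod \<chi> {..<i}) \<star> v" if "i \<le> n" "j \<le> n" for i j
    by (simp only: mult.assoc weight_\<Gamma>[OF v that(1)] weight_\<Gamma>[OF v that(2)] scale_simps)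
  from this[OF ij] this[OF ij(2,1)] show "\<Gamma> i * \<Gamma> j * v = \<Gamma> j * \<Gamma> i * v"
    by (simp only: mult.commute)
qed

definition twist :: "(nat \<Rightarrow> 'a) \<Rightarrow> nat \<Rightarrow> 'a" where
  "twist Z i = Z i * \<Gamma> i"

lemma twist_covariant:
  assumes Z: "covariant f Z" and \<pi>: "\<pi> permutes {..<n}" and g: "mon n a \<pi> \<in> G" and i: "i < n"
  shows "D' (mon n a \<pi>) * twist Z i = f (a i) \<star> (twist Z (\<pi> i) * D' (mon n a \<pi>))"
proof (rule eq_on_weight_vectors)
  fix \<chi> v assume v: "weight \<chi> v"
  let ?g = "mon n a \<pi>"
  have \<pi>i: "\<pi> i < n" using permutes_in_image[OF \<pi>, of i] i by simp
  have "D' ?g * twist Z i * v = (\<Prod>k<i. \<chi> k) \<star> (D' ?g * (Z i * v))"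
    using v i by (simp add: twist_def mult.assoc weight_\<Gamma> scale_simps)
  also have "D' ?g * (Z i * v) = inversion_sign n \<pi> (\<chi>(i := - \<chi> i)) \<star> (D ?g * (Z i * v))"
    by (rule weight_D'[OF weight_covariant[OF Z i v] \<pi> g])
  also have "D ?g * (Z i * v) = f (a i) \<star> (Z (\<pi> i) * (D ?g * v))"
    using covariantD[OF Z \<pi> g i] by (simp add: mult.assoc[symmetric] scale_simps)
  also have "(\<Prod>k<i. \<chi> k) \<star> inversion_sign n \<pi> (\<chi>(i := - \<chi> i)) \<star> f (a i) \<star> (Z (\<pi> i) * (D ?g * v)) =
      (f (a i) * inversion_sign n \<pi> \<chi> * (\<Prod>k<\<pi> i. \<chi> (inv_into UNIV \<pi> k))) \<star> (Z (\<pi> i) * (D ?g * v))"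
  proof -
    have "(\<Prod>k<i. \<chi> k) * (inversion_sign n \<pi> (\<chi>(i := - \<chi> i)) * f (a i)) =
        (\<Prod>k<i. \<chi> k) * inversion_sign n \<pi> (\<chi>(i := - \<chi> i)) * f (a i)"
      by (simp add: mult.assoc)
    also have "\<dots> = inversion_sign n \<pi> \<chi> * (\<Prod>k<\<pi> i. \<chi> (inv_into UNIV \<pi> k)) * f (a i)"
      by (subst inversion_sign_flip[OF \<pi> i]) (simp_all add: weight_sign[OF v])
    also have "\<dots> = f (a i) * inversion_sign n \<pi> \<chi> * (\<Prod>k<\<pi> i. \<chi> (inv_into UNIV \<pi> k))"
      by (simp add: mult_ac)
    finally show ?thesis by (simp only: scale_simps)
  qed
  also have "\<dots> = (f (a i) * inversion_sign n \<pi> \<chi>) \<star> (twist Z (\<pi> i) * (D ?g * v))"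
    using weight_\<Gamma>[OF weight_D[OF v \<pi> g], of "\<pi> i"] \<pi>i by (simp add: twist_def mult.assoc scale_simps)
  also have "\<dots> = f (a i) \<star> (twist Z (\<pi> i) * D' ?g) * v"
    by (simp add: mult.assoc weight_D'[OF v \<pi> g] scale_simps)
  finally show "D' ?g * twist Z i * v = f (a i) \<star> (twist Z (\<pi> i) * D' ?g) * v" .
qed

text \<open>Exactly one of \<open>\<Gamma>\<^sub>i\<close>, \<open>\<Gamma>\<^sub>j\<close> contains the involution that anticommutes with the operator of the other index;
  the resulting relative sign turns the commutator into an anticommutator.\<close>

lemma twist_anticommutator:
  assumes Z: "covariant f Z" and W: "covariant f' W" and ij: "i < n" "j < n" "i \<noteq> j"
  shows "twist Z i * twist W j + twist W j * twist Z i =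
    (if j < i then - 1 else 1) \<star> ((Z i * W j - W j * Z i) * (\<Gamma> i * \<Gamma> j))"
proof -
  have "twist Z i * twist W j = Z i * (\<Gamma> i * W j) * \<Gamma> j"
    by (simp add: twist_def mult.assoc)
  also have "\<dots> = (if j < i then - 1 else 1) \<star> (Z i * W j * (\<Gamma> i * \<Gamma> j))"
    using ij by (simp add: \<Gamma>_covariant[OF W] scale_simps mult.assoc scale_minus)
  finally have 1: "twist Z i * twist W j = \<dots>" .
  have "twist W j * twist Z i = W j * (\<Gamma> j * Z i) * \<Gamma> i"
    by (simp add: twist_def mult.assoc)
  also have "\<dots> = (if i < j then - 1 else 1) \<star> (W j * Z i * (\<Gamma> j * \<Gamma> i))"
    using ij by (simp add: \<Gamma>_covariant[OF Z] scale_simps mult.assoc scale_minus)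
  also have "\<Gamma> j * \<Gamma> i = \<Gamma> i * \<Gamma> j" using ij by (intro \<Gamma>_commute) auto
  finally show ?thesis
    using ij unfolding 1 by (auto simp: left_diff_distrib)
qed

text \<open>\<open>\<Gamma>\<^sub>i\<close> involves only indices below \<open>i\<close>, so it commutes with both operators of index \<open>i\<close>, and its square is
  \<open>1\<close>.\<close>

lemma twist_commutator:
  assumes Z: "covariant f Z" and W: "covariant f' W" and i: "i < n"
  shows "twist Z i * twist W i - twist W i * twist Z i = Z i * W i - W i * Z i"
proof -
  have "twist Z i * twist W i = Z i * W i" if "covariant f Z" "covariant f' W" for f f' Z W
  proof -
    have "twist Z i * twist W i = Z i * (\<Gamma> i * W i) * \<Gamma> i"
      by (simp add: twist_def mult.assoc)
    also have "\<dots> = Z i * W i * (\<Gamma> i * \<Gamma> i)"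
      using i by (simp add: \<Gamma>_covariant[OF that(2)] mult.assoc)
    finally show ?thesis using i by (simp add: \<Gamma>_square)
  qed
  from this[OF Z W] this[OF W Z] show ?thesis by simp
qed

text \<open>The factor that distinguishes \<open>D'(\<sigma>\<^sub>i\<^sub>j)\<close> from \<open>D(s\<^sub>i\<^sub>j)\<close>. The projections \<open>(1 \<plusminus> \<tau>\<^sub>i \<tau>\<^sub>j) / 2\<close> separate the
  eigenspaces with \<open>\<chi>\<^sub>i = \<chi>\<^sub>j\<close> from those with \<open>\<chi>\<^sub>i \<noteq> \<chi>\<^sub>j\<close>.\<close>

lemma \<tau>_\<Theta>_swap:
  assumes ij: "i < n" "j < n" "i \<noteq> j"
  shows "\<tau> j * \<Theta> (Transposition.transpose i j) =
    (1 / 2) \<star> ((1 + \<tau> i * \<tau> j) - (if j < i then - 1 else 1) \<star> ((1 - \<tau> i * \<tau> j) * (\<Gamma> i * \<Gamma> j)))"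
proof (rule eq_on_weight_vectors)
  fix \<chi> v assume v: "weight \<chi> v"
  define s :: complex where "s = (if j < i then - 1 else 1)"
  define \<gamma> where "\<gamma> = (\<Prod>k<i. \<chi> k) * (\<Prod>k<j. \<chi> k)"
  have "\<tau> j * \<Theta> (Transposition.transpose i j) * v =
      (\<chi> j * inversion_sign n (Transposition.transpose i j) \<chi>) \<star> v"
    using ij v by (simp add: mult.assoc weight_\<Theta> weight_\<tau> scale_simps mult.commute)
  also have "\<chi> j * inversion_sign n (Transposition.transpose i j) \<chi> =
      (1 / 2) * ((1 + \<chi> i * \<chi> j) - s * (\<gamma> - \<chi> i * \<chi> j * \<gamma>))"
    by (subst inversion_sign_swap[OF ij])
       (auto simp: weight_sign[OF v] s_def \<gamma>_def algebra_simps diff_divide_distrib add_divide_distrib)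
  also have "\<dots> \<star> v = (1 / 2) \<star> ((1 \<star> v + (\<chi> i * \<chi> j) \<star> v) - s \<star> (\<gamma> \<star> v - (\<chi> i * \<chi> j * \<gamma>) \<star> v))"
    by (simp only: scale_add(3,4)[symmetric] scale_simps)
  also have "\<dots> = (1 / 2) \<star> ((1 + \<tau> i * \<tau> j) - s \<star> ((1 - \<tau> i * \<tau> j) * (\<Gamma> i * \<Gamma> j))) * v"
    using ij v by (simp add: weight_\<Gamma> weight_\<tau>[OF v] scale_simps mult.assoc distrib_right
        left_diff_distrib \<gamma>_def mult.commute mult.left_commute)
  finally show "\<tau> j * \<Theta> (Transposition.transpose i j) * v =
      (1 / 2) \<star> ((1 + \<tau> i * \<tau> j) - (if j < i then - 1 else 1) \<star>
        ((1 - \<tau> i * \<tau> j) * (\<Gamma> i * \<Gamma> j))) * v"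
    unfolding s_def .
qed

end

section \<open>The groups and their reflections\<close>

lemma mon_unit_vec:
  assumes "\<pi> permutes {..<n}" "i < n"
  shows "mon n a \<pi> *\<^sub>v unit_vec n i = a i \<cdot>\<^sub>v unit_vec n (\<pi> i)"
  using assms unfolding mon_def by (intro lin_unit) auto

lemma dual_act_mon:
  assumes \<pi>: "\<pi> permutes {..<n}" and a: "\<And>k. k < n \<Longrightarrow> a k \<noteq> 0" and i: "i < n"
  shows "dual_act n (mon n a \<pi>) (unit_vec n i) = inverse (a i) \<cdot>\<^sub>v unit_vec n (\<pi> i)"
proof -
  let ?\<pi>' = "inv_into UNIV \<pi>"
  let ?h = "mon n (\<lambda>k. inverse (a (?\<pi>' k))) ?\<pi>'"
  note \<pi>' = permutes_inv[OF \<pi>]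
  have lt: "?\<pi>' k < n" "\<pi> k < n" if "k < n" for k
    using that permutes_in_image[OF \<pi>', of k] permutes_in_image[OF \<pi>, of k] by auto
  interpret ring "Mat n" by (rule ring_mat)
  have "mon n a \<pi> * ?h = 1\<^sub>m n" "?h * mon n a \<pi> = 1\<^sub>m n"
    unfolding mon_mult[OF \<pi>] mon_mult[OF \<pi>'] mon_one permutes_inv_o[OF \<pi>]
    by (auto simp: a lt permutes_inverses[OF \<pi>] intro!: mon_cong)
  then have inv: "inv\<^bsub>Mat n\<^esub> (mon n a \<pi>) = ?h"
    by (intro inv_unique'[symmetric]) (auto simp: ring_mat_def)
  have "dual_act n (mon n a \<pi>) (unit_vec n i) =
      vec n (\<lambda>j. unit_vec n i \<bullet> (inverse (a (?\<pi>' j)) \<cdot>\<^sub>v unit_vec n (?\<pi>' j)))"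
    unfolding dual_act_def inv by (auto intro!: eq_vecI simp: mon_unit_vec[OF \<pi>'])
  also have "\<dots> = inverse (a i) \<cdot>\<^sub>v unit_vec n (\<pi> i)"
    using i lt by (intro eq_vecI)
      (auto simp: scalar_prod_left_unit index_unit_vec(1) permutes_inv_eq[OF \<pi>] permutes_inverses[OF \<pi>])
  finally show ?thesis .
qed

lemma ev_x_of_unit: "r < n \<Longrightarrow> ev \<phi> (x_of n (a \<cdot>\<^sub>v unit_vec n r)) = a \<star> \<phi> (GX r)"
  and ev_y_of_unit: "r < n \<Longrightarrow> ev \<phi> (y_of n (a \<cdot>\<^sub>v unit_vec n r)) = a \<star> \<phi> (GY r)"
proof -
  have "(\<Sum>j<n. sc ((a \<cdot>\<^sub>v unit_vec n r) $ j) * f j) = a \<star> f r" if "r < n" for f :: "nat \<Rightarrow> 'a"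
  proof -
    have "(\<Sum>j<n. sc ((a \<cdot>\<^sub>v unit_vec n r) $ j) * f j) = (\<Sum>j<n. if j = r then a \<star> f r else 0)"
      using that by (intro sum.cong) (auto simp: unit_vec_def scale_def)
    then show ?thesis using that by simp
  qed
  then show "r < n \<Longrightarrow> ev \<phi> (x_of n (a \<cdot>\<^sub>v unit_vec n r)) = a \<star> \<phi> (GX r)"
    "r < n \<Longrightarrow> ev \<phi> (y_of n (a \<cdot>\<^sub>v unit_vec n r)) = a \<star> \<phi> (GY r)"
    by (simp_all add: x_of_def y_of_def ev_simps)
qed

text \<open>A permutation matrix has determinant \<open>1\<close> or \<open>- 1\<close>, and both are \<open>(m / p)\<close>-th roots of unity.\<close>

lemma mu_group_subset_G_group:
  assumes "even (m div p)"
  shows "mu_group m p n \<subseteq> G_group m p n"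
proof
  fix g assume "g \<in> mu_group m p n"
  then obtain \<pi> a where \<pi>: "\<pi> permutes {..<n}" and g: "g = mon n a \<pi>"
    and a: "\<forall>k<n. a k ^ m = 1" and det: "det g \<in> roots (m div p)"
    unfolding mu_group_iff by blast
  let ?w = "mon n (\<lambda>_. 1) \<pi>"
  have "?w * mon n (\<lambda>_. 1) (inv_into UNIV \<pi>) = 1\<^sub>m n"
    unfolding mon_mult[OF permutes_inv[OF \<pi>]] mon_one permutes_inv_o[OF \<pi>] by simp
  moreover have "mon n (\<lambda>_. 1) (inv_into UNIV \<pi>) = transpose_mat ?w"
    by (rule eq_matI) (auto simp: mon_index permutes_inverses[OF \<pi>])
  ultimately have "det ?w * det ?w = 1"
    using det_mult[of ?w n "transpose_mat ?w"] det_transpose[of ?w n] by simp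
  then have w: "det ?w = 1 \<or> det ?w = -1"
    by (simp add: square_eq_1_iff)
  have "det g = det ?w * (\<Prod>k<n. a k)"
    using det_mult[of ?w n "mon n a id"] by (simp add: g mon_mult permutes_id det_mon_id)
  with w have "(\<Prod>k<n. a k) = det g \<or> (\<Prod>k<n. a k) = - det g"
    by auto
  then have "(\<Prod>k<n. a k) \<in> roots (m div p)"
    using det assms by (auto simp: roots_def)
  then show "g \<in> G_group m p n"
    unfolding G_group_iff using \<pi> g a by blast
qed

lemma s_elt_mon:
  "i \<noteq> j \<Longrightarrow> s_elt n i j \<epsilon> =
    mon n (\<lambda>k. if k = i then inverse \<epsilon> else if k = j then \<epsilon> else 1) (Transposition.transpose i j)"
  unfolding s_elt_def mon_def by (intro lin_cong) (auto simp: transpose_def)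

lemma sigma_elt_mon:
  "i \<noteq> j \<Longrightarrow> sigma_elt n i j \<epsilon> =
    mon n (\<lambda>k. if k = i then inverse \<epsilon> else if k = j then - \<epsilon> else 1) (Transposition.transpose i j)"
  unfolding sigma_elt_def mon_def by (intro lin_cong) (auto simp: transpose_def)

lemma sigma_elt_eq: "i \<noteq> j \<Longrightarrow> sigma_elt n i j \<epsilon> = s_elt n i j \<epsilon> * t_elt n j (-1)"
  by (auto simp: s_elt_mon sigma_elt_mon t_elt_mon mon_mult permutes_id intro!: mon_cong)

lemma s_elt_uminus: "i \<noteq> j \<Longrightarrow> s_elt n i j \<epsilon> * (t_elt n i (-1) * t_elt n j (-1)) = s_elt n i j (- \<epsilon>)"
  by (auto simp: s_elt_mon t_elt_mon mon_mult permutes_id inverse_minus_eq intro!: mon_cong)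

lemma sum_roots_uminus:
  assumes "even m"
  shows "(\<Sum>\<epsilon>\<in>roots m. f (- \<epsilon>)) = (\<Sum>\<epsilon>\<in>roots m. f \<epsilon>)"
  using assms by (intro sum.reindex_bij_witness[of _ uminus uminus]) (auto simp: roots_def)

context G_representation
begin

lemma even_m: "even m"
  using even_quot p by (metis dvd_mult_div_cancel even_mult_iff)

lemma s_elt_\<tau>:
  assumes ij: "i < n" "j < n" "i \<noteq> j" and \<epsilon>: "\<epsilon> \<in> roots m"
  shows "D (s_elt n i j \<epsilon>) * (\<tau> i * \<tau> j) = D (s_elt n i j (- \<epsilon>))"
proof -
  have "D (s_elt n i j \<epsilon>) * (\<tau> i * \<tau> j) = D (s_elt n i j \<epsilon> * (t_elt n i (-1) * t_elt n j (-1)))"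
    using ij \<epsilon> m by (simp add: \<tau>_def D_mult s_elt_in_G sign_mem_G G_mult)
  then show ?thesis by (simp add: s_elt_uminus ij)
qed

text \<open>Multiplication by \<open>\<tau>\<^sub>i \<tau>\<^sub>j\<close> replaces \<open>\<epsilon>\<close> by \<open>- \<epsilon>\<close> in \<open>D(s\<^sub>i\<^sub>j\<^bsup>(\<epsilon>)\<^esup>)\<close>, so the two projections in
  \<open>\<tau>_\<Theta>_swap\<close> become half-sums and half-differences.\<close>

lemma D'_sigma:
  assumes ij: "i < n" "j < n" "i \<noteq> j" and \<epsilon>: "\<epsilon> \<in> roots m"
  shows "D' (sigma_elt n i j \<epsilon>) = (1 / 2) \<star> (D (s_elt n i j \<epsilon>) + D (s_elt n i j (- \<epsilon>)) -
    (if j < i then - 1 else 1) \<star> ((D (s_elt n i j \<epsilon>) - D (s_elt n i j (- \<epsilon>))) * (\<Gamma> i * \<Gamma> j)))"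
proof -
  let ?s = "D (s_elt n i j \<epsilon>)"
  have s: "s_elt n i j \<epsilon> \<in> G" using ij \<epsilon> m by (intro s_elt_in_G)
  have "sigma_elt n i j \<epsilon> \<in> G"
    unfolding sigma_elt_eq[OF ij(3)] using ij by (intro G_mult s sign_mem_G)
  then have "D' (sigma_elt n i j \<epsilon>) = D (sigma_elt n i j \<epsilon>) * \<Theta> (Transposition.transpose i j)"
    unfolding sigma_elt_mon[OF ij(3)] using ij by (intro D'_mon permutes_swap_id) auto
  also have "D (sigma_elt n i j \<epsilon>) = ?s * \<tau> j"
    unfolding sigma_elt_eq[OF ij(3)] \<tau>_def using ij by (intro D_mult s sign_mem_G)
  also have "?s * \<tau> j * \<Theta> (Transposition.transpose i j) = (1 / 2) \<star> (?s + ?s * (\<tau> i * \<tau> j) -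
      (if j < i then - 1 else 1) \<star> ((?s - ?s * (\<tau> i * \<tau> j)) * (\<Gamma> i * \<Gamma> j)))"
    unfolding mult.assoc[of ?s "\<tau> j"] \<tau>_\<Theta>_swap[OF ij]
    by (simp only: scale_simps right_diff_distrib left_diff_distrib distrib_left mult_1_right mult_1_left mult.assoc)
  finally show ?thesis unfolding s_elt_\<tau>[OF ij \<epsilon>] .
qed

text \<open>Substituting \<open>- \<epsilon>\<close> for \<open>\<epsilon>\<close> in the terms with \<open>D(s\<^sub>i\<^sub>j\<^bsup>(-\<epsilon>)\<^esup>)\<close> leaves the even part of \<open>f\<close> in the first
  summand and the odd part in the second. Constant \<open>f\<close> is even, and the identity is odd.\<close>

lemma sum_scaled_D'_sigma:
  assumes ij: "i < n" "j < n" "i \<noteq> j"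
  shows "(\<Sum>\<epsilon>\<in>roots m. f \<epsilon> \<star> D' (sigma_elt n i j \<epsilon>)) = (1 / 2) \<star>
    ((\<Sum>\<epsilon>\<in>roots m. f \<epsilon> \<star> D (s_elt n i j \<epsilon>)) + (\<Sum>\<epsilon>\<in>roots m. f (- \<epsilon>) \<star> D (s_elt n i j \<epsilon>)) -
     (if j < i then - 1 else 1) \<star> (((\<Sum>\<epsilon>\<in>roots m. f \<epsilon> \<star> D (s_elt n i j \<epsilon>)) -
       (\<Sum>\<epsilon>\<in>roots m. f (- \<epsilon>) \<star> D (s_elt n i j \<epsilon>))) * (\<Gamma> i * \<Gamma> j)))"
proof -
  define e :: complex where "e = (if j < i then - 1 else 1)"
  define T where "T = \<Gamma> i * \<Gamma> j"
  let ?s = "\<lambda>\<epsilon>. D (s_elt n i j \<epsilon>)"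
  have "(\<Sum>\<epsilon>\<in>roots m. f \<epsilon> \<star> D' (sigma_elt n i j \<epsilon>)) =
      (\<Sum>\<epsilon>\<in>roots m. (1 / 2) \<star> (f \<epsilon> \<star> ?s \<epsilon> + f \<epsilon> \<star> ?s (- \<epsilon>) - e \<star> ((f \<epsilon> \<star> ?s \<epsilon> - f \<epsilon> \<star> ?s (- \<epsilon>)) * T)))"
    by (intro sum.cong refl)
      (simp add: D'_sigma[OF ij] e_def[symmetric] T_def[symmetric] scale_simps scale_add
        left_diff_distrib mult.commute mult.left_commute)
  also have "\<dots> = (1 / 2) \<star> ((\<Sum>\<epsilon>\<in>roots m. f \<epsilon> \<star> ?s \<epsilon>) + (\<Sum>\<epsilon>\<in>roots m. f \<epsilon> \<star> ?s (- \<epsilon>)) -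
      e \<star> (((\<Sum>\<epsilon>\<in>roots m. f \<epsilon> \<star> ?s \<epsilon>) - (\<Sum>\<epsilon>\<in>roots m. f \<epsilon> \<star> ?s (- \<epsilon>))) * T))"
    by (simp only: scale_sum[symmetric] sum.distrib sum_subtractf sum_distrib_right[symmetric])
  also have "(\<Sum>\<epsilon>\<in>roots m. f \<epsilon> \<star> ?s (- \<epsilon>)) = (\<Sum>\<epsilon>\<in>roots m. f (- \<epsilon>) \<star> ?s \<epsilon>)"
    using sum_roots_uminus[OF even_m, of "\<lambda>\<epsilon>. f (- \<epsilon>) \<star> ?s \<epsilon>"] by simp
  finally show ?thesis unfolding e_def T_def .
qed

lemma sum_D'_sigma:
  assumes ij: "i < n" "j < n" "i \<noteq> j"
  shows "(\<Sum>\<epsilon>\<in>roots m. D' (sigma_elt n i j \<epsilon>)) = (\<Sum>\<epsilon>\<in>roots m. D (s_elt n i j \<epsilon>))"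
  using sum_scaled_D'_sigma[OF ij, of "\<lambda>_. 1"] by (simp add: scale_add scale_double)

lemma sum_weighted_D'_sigma:
  assumes ij: "i < n" "j < n" "i \<noteq> j"
  shows "(\<Sum>\<epsilon>\<in>roots m. \<epsilon> \<star> D' (sigma_elt n i j \<epsilon>)) =
    - ((if j < i then - 1 else 1) \<star> ((\<Sum>\<epsilon>\<in>roots m. \<epsilon> \<star> D (s_elt n i j \<epsilon>)) * (\<Gamma> i * \<Gamma> j)))"
proof -
  let ?S = "\<Sum>\<epsilon>\<in>roots m. \<epsilon> \<star> D (s_elt n i j \<epsilon>)"
  have "(\<Sum>\<epsilon>\<in>roots m. \<epsilon> \<star> D' (sigma_elt n i j \<epsilon>)) =
      (1 / 2) \<star> (?S + - ?S - (if j < i then - 1 else 1) \<star> ((?S - - ?S) * (\<Gamma> i * \<Gamma> j)))"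
    using sum_scaled_D'_sigma[OF ij, of "\<lambda>\<epsilon>. \<epsilon>"] by (simp only: scale_minus sum_negf)
  then show ?thesis
    by (simp add: scale_add scale_minus scale_double distrib_right scale_simps)
qed

end

section \<open>Twisting a representation of the Cherednik algebra\<close>

definition twisted_gens :: "nat \<Rightarrow> (cgen \<Rightarrow> 'a::complex_algebra_1) \<Rightarrow> cgen \<Rightarrow> 'a" where
  "twisted_gens n \<phi> = (\<lambda>x. case x of
     GX i \<Rightarrow> G_representation.twist n (\<lambda>g. \<phi> (GG g)) (\<lambda>i. \<phi> (GX i)) i
   | GY i \<Rightarrow> G_representation.twist n (\<lambda>g. \<phi> (GG g)) (\<lambda>i. \<phi> (GY i)) i
   | GG g \<Rightarrow> G_representation.D' n (\<lambda>g. \<phi> (GG g)) g)"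

lemma G_representation_of_relations:
  assumes "m > 0" "p dvd m" "even (m div p)"
    and H: "\<And>r. r \<in> group_algebra_rels n (G_group m p n) \<Longrightarrow> ev \<phi> r = 0"
  shows "G_representation m p n (\<lambda>g. \<phi> (GG g))"
proof
  show "\<phi> (GG (1\<^sub>m n)) = 1"
    using H[of "grp (1\<^sub>m n) - 1"] by (auto simp: group_algebra_rels_def ev_simps)
  show "\<phi> (GG (g * h)) = \<phi> (GG g) * \<phi> (GG h)"
    if "g \<in> G_group m p n" "h \<in> G_group m p n" for g h
    using H[of "grp g * grp h - grp (g * h)"] that by (force simp: group_algebra_rels_def ev_simps)
qed (use assms in auto)

lemma twisted_gens_satisfy_braided_relations:
  fixes \<phi> :: "cgen \<Rightarrow> 'a::complex_algebra_1"
  assumes m: "m > 0" and p: "p dvd m" and even: "even (m div p)"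
    and H: "\<And>r. r \<in> group_algebra_rels n (G_group m p n) \<union> action_rels n (G_group m p n) \<union>
      H_rels m p n c1 c \<Longrightarrow> ev \<phi> r = 0"
    and r: "r \<in> group_algebra_rels n (mu_group m p n) \<union> action_rels n (mu_group m p n) \<union>
      braided_H_rels m p n (- c1) (\<lambda>\<zeta>. - c \<zeta>)"
  shows "ev (twisted_gens n \<phi>) r = 0"
proof -
  define D where "D g = \<phi> (GG g)" for g
  define X where "X i = \<phi> (GX i)" for i
  define Y where "Y i = \<phi> (GY i)" for i
  note defs = D_def X_def Y_def
  interpret G_representation m p n D
    unfolding D_def using H by (intro G_representation_of_relations m p even) auto
  have "D (mon n a \<pi>) * X i = a i \<star> (X (\<pi> i) * D (mon n a \<pi>)) \<and>
      D (mon n a \<pi>) * Y i = inverse (a i) \<star> (Y (\<pi> i) * D (mon n a \<pi>))"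
    if \<pi>: "\<pi> permutes {..<n}" and g: "mon n a \<pi> \<in> G" and i: "i < n" for \<pi> a i
  proof
    have \<pi>i: "\<pi> i < n" using permutes_in_image[OF \<pi>, of i] i by simp
    let ?g = "mon n a \<pi>"
    have "ev \<phi> (grp ?g * xg i - x_of n (?g *\<^sub>v unit_vec n i) * grp ?g) = 0"
      using g i by (intro H) (auto simp: action_rels_def)
    then show "D ?g * X i = a i \<star> (X (\<pi> i) * D ?g)"
      by (simp add: mon_unit_vec \<pi> i ev_simps ev_x_of_unit \<pi>i defs scale_simps)
    have "ev \<phi> (grp ?g * yg i - y_of n (dual_act n ?g (unit_vec n i)) * grp ?g) = 0"
      using g i by (intro H) (auto simp: action_rels_def)
    then show "D ?g * Y i = inverse (a i) \<star> (Y (\<pi> i) * D ?g)"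
      by (simp add: dual_act_mon \<pi> i mon_G_nonzero[OF \<pi> g] ev_simps ev_y_of_unit \<pi>i defs scale_simps)
  qed
  then have X: "covariant (\<lambda>a. a) X" and Y: "covariant inverse Y"
    unfolding covariant_def by simp_all
  have XX: "X i * X j = X j * X i" and YY: "Y i * Y j = Y j * Y i" if ij: "i < n" "j < n" for i j
  proof -
    have "xg i * xg j - xg j * xg i \<in> H_rels m p n c1 c" "yg i * yg j - yg j * yg i \<in> H_rels m p n c1 c"
      using ij unfolding H_rels_def by blast+
    then have "ev \<phi> (xg i * xg j - xg j * xg i) = 0" "ev \<phi> (yg i * yg j - yg j * yg i) = 0"
      using H by blast+
    then show "X i * X j = X j * X i" "Y i * Y j = Y j * Y i"
      by (simp_all add: ev_simps defs)
  qed
  have YX: "Y i * X j - X j * Y i = c1 \<star> (\<Sum>\<epsilon>\<in>roots m. \<epsilon> \<star> D (s_elt n i j \<epsilon>))"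
    if ij: "i < n" "j < n" "i \<noteq> j" for i j
  proof -
    have "ev \<phi> ((yg i * xg j - xg j * yg i) -
        scal c1 * (\<Sum>\<epsilon>\<in>roots m. scal \<epsilon> * grp (s_elt n i j \<epsilon>))) = 0"
      by (intro H UnI2) (use ij in \<open>unfold H_rels_def, blast\<close>)
    then show ?thesis by (simp add: ev_simps defs scale_def)
  qed
  have YX_diag: "Y i * X i - X i * Y i =
      1 - c1 \<star> (\<Sum>j\<in>{..<n} - {i}. \<Sum>\<epsilon>\<in>roots m. D (s_elt n i j \<epsilon>)) -
      (\<Sum>\<zeta>\<in>roots (m div p) - {1}. c \<zeta> \<star> D (t_elt n i \<zeta>))" if i: "i < n" for i
  proof -
    have "ev \<phi> ((yg i * xg i - xg i * yg i) -
        (1 - scal c1 * (\<Sum>j\<in>{..<n} - {i}. \<Sum>\<epsilon>\<in>roots m. grp (s_elt n i j \<epsilon>))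
           - (\<Sum>\<zeta>\<in>roots (m div p) - {1}. scal (c \<zeta>) * grp (t_elt n i \<zeta>)))) = 0"
      by (intro H UnI2) (use i in \<open>unfold H_rels_def, blast\<close>)
    then show ?thesis by (simp add: ev_simps defs scale_def)
  qed
  let ?\<psi> = "twisted_gens n \<phi>"
  have \<psi>: "?\<psi> (GX i) = twist X i" "?\<psi> (GY i) = twist Y i" "?\<psi> (GG g) = D' g" for i g
    unfolding twisted_gens_def X_def[abs_def] Y_def[abs_def] D_def[abs_def] by simp_all
  note mu_G = mu_group_subset_G_group[OF even, of n, THEN subsetD]
  have group: "ev ?\<psi> r = 0" if "r \<in> group_algebra_rels n (mu_group m p n)"
    using that by (auto simp: group_algebra_rels_def ev_simps \<psi> D'_one D'_mult mu_G)
  have action: "ev ?\<psi> r = 0" if "r \<in> action_rels n (mu_group m p n)"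
  proof -
    from that obtain g i where g: "g \<in> mu_group m p n" and i: "i < n" and
      r: "r = grp g * xg i - x_of n (g *\<^sub>v unit_vec n i) * grp g \<or>
          r = grp g * yg i - y_of n (dual_act n g (unit_vec n i)) * grp g"
      unfolding action_rels_def by blast
    from mu_G[OF g] obtain \<pi> a where \<pi>: "\<pi> permutes {..<n}" and ga: "g = mon n a \<pi>"
      unfolding G_group_iff by blast
    have gG: "mon n a \<pi> \<in> G" using mu_G[OF g] ga by simp
    have \<pi>i: "\<pi> i < n" using permutes_in_image[OF \<pi>, of i] i by simp
    show ?thesis
      using r unfolding ga
      by (auto simp: ev_simps \<psi> mon_unit_vec \<pi> i dual_act_mon mon_G_nonzero[OF \<pi> gG] ev_x_of_unit
          ev_y_of_unit \<pi>i scale_simps twist_covariant[OF X \<pi> gG i] twist_covariant[OF Y \<pi> gG i])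
  qed
  have braided: "ev ?\<psi> r = 0" if "r \<in> braided_H_rels m p n (- c1) (\<lambda>\<zeta>. - c \<zeta>)"
  proof -
    have 1: "ev ?\<psi> (xg i * xg j + xg j * xg i) = 0" "ev ?\<psi> (yg i * yg j + yg j * yg i) = 0"
      if "i < n" "j < n" "i \<noteq> j" for i j
      using twist_anticommutator[OF X X that] twist_anticommutator[OF Y Y that] that
      by (simp_all add: ev_simps \<psi> XX YY)
    have 2: "ev ?\<psi> ((yg i * xg j + xg j * yg i) -
        scal (- c1) * (\<Sum>\<epsilon>\<in>roots m. scal \<epsilon> * grp (sigma_elt n i j \<epsilon>))) = 0"
      if ij: "i < n" "j < n" "i \<noteq> j" for i j
    proof -
      have "ev ?\<psi> (scal (- c1) * (\<Sum>\<epsilon>\<in>roots m. scal \<epsilon> * grp (sigma_elt n i j \<epsilon>))) =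
          (- c1) \<star> (\<Sum>\<epsilon>\<in>roots m. \<epsilon> \<star> D' (sigma_elt n i j \<epsilon>))"
        by (simp add: ev_simps \<psi> scale_def)
      also have "\<dots> = (if j < i then - 1 else 1) \<star>
          ((c1 \<star> (\<Sum>\<epsilon>\<in>roots m. \<epsilon> \<star> D (s_elt n i j \<epsilon>))) * (\<Gamma> i * \<Gamma> j))"
        unfolding sum_weighted_D'_sigma[OF ij] scale_minus minus_minus
        by (simp only: scale_simps mult.commute)
      also have "\<dots> = ev ?\<psi> (yg i * xg j + xg j * yg i)"
        unfolding YX[OF ij, symmetric] twist_anticommutator[OF Y X ij, symmetric]
        by (simp add: ev_simps \<psi>)
      finally show ?thesis unfolding ev_diff by simp
    qed
    have 3: "ev ?\<psi> ((yg i * xg i - xg i * yg i) -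
        (1 + scal (- c1) * (\<Sum>j\<in>{..<n} - {i}. \<Sum>\<epsilon>\<in>roots m. grp (sigma_elt n i j \<epsilon>))
           + (\<Sum>\<zeta>\<in>roots (m div p) - {1}. scal (- c \<zeta>) * grp (t_elt n i \<zeta>)))) = 0"
      if i: "i < n" for i
    proof -
      have s: "(\<Sum>j\<in>{..<n} - {i}. \<Sum>\<epsilon>\<in>roots m. D' (sigma_elt n i j \<epsilon>)) =
          (\<Sum>j\<in>{..<n} - {i}. \<Sum>\<epsilon>\<in>roots m. D (s_elt n i j \<epsilon>))"
        using i by (intro sum.cong refl sum_D'_sigma) auto
      have "D' (t_elt n i \<zeta>) = D (t_elt n i \<zeta>)" if "\<zeta> \<in> roots (m div p)" for \<zeta>
        using t_elt_in_G[OF i that p] unfolding t_elt_mon by (rule D'_diagonal)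
      then have t: "(\<Sum>\<zeta>\<in>roots (m div p) - {1}. c \<zeta> \<star> D' (t_elt n i \<zeta>)) =
          (\<Sum>\<zeta>\<in>roots (m div p) - {1}. c \<zeta> \<star> D (t_elt n i \<zeta>))"
        by (intro sum.cong) auto
      have "twist Y i * twist X i - twist X i * twist Y i =
          1 - c1 \<star> (\<Sum>j\<in>{..<n} - {i}. \<Sum>\<epsilon>\<in>roots m. D' (sigma_elt n i j \<epsilon>)) -
          (\<Sum>\<zeta>\<in>roots (m div p) - {1}. c \<zeta> \<star> D' (t_elt n i \<zeta>))"
        unfolding s t twist_commutator[OF Y X i] by (rule YX_diag[OF i])
      then show ?thesis
        by (simp add: ev_simps \<psi> scale_def sc_minus sum_negf)
    qed
    show ?thesis
      using that 1 2 3 unfolding braided_H_rels_def by blast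
  qed
  from r group action braided show ?thesis by blast
qed

text \<open>The twisted operators are polynomials in the original ones, hence again given by matrices of the same
  size.\<close>

lemma twisted_gens_in_blocks:
  assumes d: "d > 0" and \<phi>: "range \<phi> \<subseteq> blocks d"
    and "G_representation m p n (\<lambda>g. \<phi> (GG g))"
  shows "range (twisted_gens n \<phi>) \<subseteq> blocks d"
proof -
  interpret G_representation m p n "\<lambda>g. \<phi> (GG g)" by fact
  have gens: "\<phi> x \<in> blocks d" for x using \<phi> by auto
  then have \<tau>: "\<tau> k \<in> blocks d" for k by (simp add: \<tau>_def)
  have \<Gamma>: "\<Gamma> i \<in> blocks d" for i
    unfolding \<Gamma>_def using d \<tau> by (intro blocks_prod_list) auto
  have CZ: "CZ a b \<in> blocks d" for a b
    unfolding CZ_def scale_def by (intro blocks_closed d \<tau>)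
  have "\<Theta> \<pi> \<in> blocks d" for \<pi>
  proof -
    have "prod_list (map (\<lambda>b. if a < b \<and> \<pi> b < \<pi> a then CZ a b else 1) [0..<n]) \<in> blocks d" for a
      using d CZ by (intro blocks_prod_list) (auto simp: blocks_closed)
    then show ?thesis
      unfolding \<Theta>_def using d by (intro blocks_prod_list) auto
  qed
  then have "twisted_gens n \<phi> x \<in> blocks d" for x
    using d gens \<Gamma> by (cases x) (auto simp: twisted_gens_def twist_def D'_def blocks_closed)
  then show ?thesis by blast
qed

theorem theorem6p2:
  fixes m p n :: nat and c1 :: complex and c :: "complex \<Rightarrow> complex"
  assumes "m > 0" and "even m"
    and "p > 0" and "p dvd m" and "even (m div p)"
    and "n \<ge> 3 \<or> (n = 2 \<and> odd p)"
    and "has_nonzero_fd_representation (cherednik_algebra m p n c1 c)"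
  shows "has_nonzero_fd_representation (neg_braided_cherednik_algebra m p n (- c1) (\<lambda>\<zeta>. - c \<zeta>))"
proof -
  obtain d \<rho> where d: "d > 0" and rep: "representation (cherednik_algebra m p n c1 c) d \<rho>"
    using assms(7) unfolding has_nonzero_fd_representation_def by blast
  obtain \<phi> :: "cgen \<Rightarrow> endo" where \<phi>: "range \<phi> \<subseteq> blocks d"
    and H: "\<And>r. r \<in> group_algebra_rels n (G_group m p n) \<union> action_rels n (G_group m p n) \<union>
      H_rels m p n c1 c \<Longrightarrow> ev \<phi> r = 0"
    using relations_of_representation[OF d cherednik_rels_carrier[OF assms(1,4)]
        rep[unfolded cherednik_algebra_def]] by blast
  have "\<exists>\<rho>'. representation (neg_braided_cherednik_algebra m p n (- c1) (\<lambda>\<zeta>. - c \<zeta>)) d \<rho>'"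
    unfolding neg_braided_cherednik_algebra_def
    by (intro representation_of_relations[OF d braided_rels_carrier[OF assms(1,2,4)], of "twisted_gens n \<phi>"]
        twisted_gens_in_blocks[OF d \<phi> G_representation_of_relations[OF assms(1,4,5) H[OF UnI1[OF UnI1]]]]
        twisted_gens_satisfy_braided_relations[OF assms(1,4,5) H])
  with d show ?thesis unfolding has_nonzero_fd_representation_def by blast
qed

end
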